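(* Let $d>1$ and let $\Gamma$ be a sub-semigroup of $GL(d,\mathbb{R})$ which is strongly irreducible and contains an element which is both proximal and expanding. Let $\Sigma$ be a $\Gamma$-invariant subset of $\tilde V\setminus\{0\}$ and suppose $0\in\overline{\Sigma}$. Then $$\overline{\Sigma}\supset \tilde L_\Gamma/\{\sigma,\mathrm{Id}\},$$ the closure being taken in $\tilde V$.
   Context: $V=\mathbb{R}^d$, $\sigma:v\mapsto -v$ is the symmetry of $V$, and $\tilde V=V/\{\sigma,\mathrm{Id}\}$ is the factor space, on which $GL(d,\mathbb{R})$ acts. A matrix $\gamma\in GL(d,\mathbb{R})$ is proximal if it has an eigenvalue $\lambda_\gamma$ with $|\lambda_\gamma|>|\lambda|$ for all other (complex) eigenvalues $\lambda$ of $\gamma$, counted with algebraic multiplicity (so $\lambda_\gamma$ is real and simple); an eigenvector for $\lambda_\gamma$ is called a dominant eigenvector of $\gamma$. It is expanding if it has an eigenvalue $\lambda$ with $|\lambda|>1$. $\Gamma$ is strongly irreducible if there is no finite union $W_1\cup\dots\cup W_n$ ($n\ge 1$) of non-zero proper subspaces of $V$ which is $\Gamma$-invariant. A set $\Sigma$ is $\Gamma$-invariant if $\gamma\Sigma\subset\Sigma$ for all $\gamma\in\Gamma$. $L_\Gamma\subset\mathbb{P}^{d-1}$ is the closure of the set of directions of dominant eigenvectors of the proximal elements of $\Gamma$, and $\tilde L_\Gamma\subset V\setminus\{0\}$ is the set of non-zero vectors whose direction belongs to $L_\Gamma$; $\tilde L_\Gamma/\{\sigma,\mathrm{Id}\}$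 is its image in $\tilde V$. *)

theory Defs
  imports "HOL-Analysis.Analysis" "HOL-Computational_Algebra.Computational_Algebra"
begin

section \<open>Quotient topologies\<close>

definition quotient_topology :: "'a topology \<Rightarrow> ('a \<Rightarrow> 'b) \<Rightarrow> 'b topology" where
  "quotient_topology X f =
     topology (\<lambda>U. U \<subseteq> f ` topspace X \<and> openin X {x \<in> topspace X. f x \<in> U})"

lemma openin_quotient_topology:
  "openin (quotient_topology X f) U \<longleftrightarrow>
     U \<subseteq> f ` topspace X \<and> openin X {x \<in> topspace X. f x \<in> U}"
proof -
  have "istopology (\<lambda>U. U \<subseteq> f ` topspace X \<and> openin X {x \<in> topspace X. f x \<in> U})"
    unfolding istopology_def
  proof (intro conjI allI impI)
    fix S T
    assume S: "S \<subseteq> f ` topspace X \<and> openin X {x \<in> topspace X. f x \<in> S}"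
      and T: "T \<subseteq> f ` topspace X \<and> openin X {x \<in> topspace X. f x \<in> T}"
    show "S \<inter> T \<subseteq> f ` topspace X" using S by blast
    have "{x \<in> topspace X. f x \<in> S \<inter> T} =
        {x \<in> topspace X. f x \<in> S} \<inter> {x \<in> topspace X. f x \<in> T}" by blast
    then show "openin X {x \<in> topspace X. f x \<in> S \<inter> T}" using S T by auto
  next
    fix K
    assume K: "\<forall>U\<in>K. U \<subseteq> f ` topspace X \<and> openin X {x \<in> topspace X. f x \<in> U}"
    show "\<Union> K \<subseteq> f ` topspace X" using K by blast
    have "{x \<in> topspace X. f x \<in> \<Union> K} = (\<Union>U\<in>K. {x \<in> topspace X. f x \<in> U})" by blast
    then show "openin X {x \<in> topspace X. f x \<in> \<Union> K}" using K by auto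
  qed
  then show ?thesis by (simp add: quotient_topology_def topology_inverse')
qed

lemma topspace_quotient_topology [simp]:
  "topspace (quotient_topology X f) = f ` topspace X"
proof -
  have "{x \<in> topspace X. f x \<in> f ` topspace X} = topspace X" by blast
  then have "openin (quotient_topology X f) (f ` topspace X)"
    by (simp add: openin_quotient_topology)
  then show ?thesis
    unfolding topspace_def using openin_quotient_topology[of X f] by blast
qed

lemma quotient_map_quotient_topology: "quotient_map X (quotient_topology X f) f"
  by (auto simp: quotient_map_def openin_quotient_topology)

section \<open>The space \<open>V / {\<sigma>, Id}\<close> and projective space\<close>

text \<open>Points of \<open>V / {\<sigma>, Id}\<close> are the orbits \<open>{v, - v}\<close>; its origin is \<open>{0}\<close>.\<close>

definition pm_class :: "real ^ 'n \<Rightarrow> (real ^ 'n) set" where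
  "pm_class v = {v, - v}"

definition pm_space :: "(real ^ 'n) set topology" where
  "pm_space = quotient_topology euclidean pm_class"

definition pm_act :: "real ^ 'n ^ 'n \<Rightarrow> (real ^ 'n) set \<Rightarrow> (real ^ 'n) set" where
  "pm_act A c = (\<lambda>v. A *v v) ` c"

lemma pm_act_pm_class: "pm_act A (pm_class v) = pm_class (A *v v)"
  by (simp add: pm_act_def pm_class_def linear_neg[OF matrix_vector_mul_linear])

definition pm_invariant :: "(real ^ 'n ^ 'n) set \<Rightarrow> (real ^ 'n) set set \<Rightarrow> bool" where
  "pm_invariant \<Gamma> \<Sigma> \<longleftrightarrow> (\<forall>\<gamma>\<in>\<Gamma>. pm_act \<gamma> ` \<Sigma> \<subseteq> \<Sigma>)"

text \<open>Points of the projective space are the lines \<open>span {v}\<close> with \<open>v \<noteq> 0\<close>.\<close>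

definition direction :: "real ^ 'n \<Rightarrow> (real ^ 'n) set" where
  "direction v = span {v}"

definition projective_space :: "(real ^ 'n) set topology" where
  "projective_space = quotient_topology (top_of_set (- {0})) direction"

section \<open>Proximal and expanding matrices\<close>

definition charpoly :: "'a::comm_ring_1 ^ 'n ^ 'n \<Rightarrow> 'a poly" where
  "charpoly A = det (mat [:0, 1:] - map_matrix (\<lambda>a. [:a:]) A)"

lemma poly_charpoly: "poly (charpoly A) x = det (mat x - A)"
proof -
  have "poly (of_int k) x = (of_int k :: 'a)" for k
    by (metis of_int_poly poly_const_conv)
  then show ?thesis
    by (auto simp: charpoly_def det_def poly_sum poly_prod mat_def
        intro!: sum.cong prod.cong arg_cong2[where f = "(*)"])
qed

text \<open>The complex eigenvalues of a real matrix, with algebraic multiplicity.\<close>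

definition eigenvalues :: "real ^ 'n ^ 'n \<Rightarrow> complex multiset" where
  "eigenvalues A = proots (charpoly (map_matrix complex_of_real A))"

definition dominant_eigenvalue :: "real ^ 'n ^ 'n \<Rightarrow> complex \<Rightarrow> bool" where
  "dominant_eigenvalue A l \<longleftrightarrow>
     l \<in># eigenvalues A \<and> (\<forall>m \<in># eigenvalues A - {#l#}. cmod l > cmod m)"

definition proximal :: "real ^ 'n ^ 'n \<Rightarrow> bool" where
  "proximal A \<longleftrightarrow> (\<exists>l. dominant_eigenvalue A l)"

definition expanding :: "real ^ 'n ^ 'n \<Rightarrow> bool" where
  "expanding A \<longleftrightarrow> (\<exists>l \<in># eigenvalues A. cmod l > 1)"

text \<open>
  Non-real eigenvalues of a real matrix come in conjugate pairs of equal modulus, so a dominant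
  eigenvalue is real.
\<close>

definition dominant_eigenvector :: "real ^ 'n ^ 'n \<Rightarrow> real ^ 'n \<Rightarrow> bool" where
  "dominant_eigenvector A v \<longleftrightarrow>
     v \<noteq> 0 \<and> (\<exists>r. dominant_eigenvalue A (complex_of_real r) \<and> A *v v = r *\<^sub>R v)"

section \<open>Linear semigroups\<close>

definition GL_subsemigroup :: "(real ^ 'n ^ 'n) set \<Rightarrow> bool" where
  "GL_subsemigroup \<Gamma> \<longleftrightarrow>
     (\<forall>\<gamma>\<in>\<Gamma>. invertible \<gamma>) \<and> (\<forall>\<gamma>\<in>\<Gamma>. \<forall>\<delta>\<in>\<Gamma>. \<gamma> ** \<delta> \<in> \<Gamma>)"

definition strongly_irreducible :: "(real ^ 'n ^ 'n) set \<Rightarrow> bool" where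
  "strongly_irreducible \<Gamma> \<longleftrightarrow>
     \<not> (\<exists>\<W>. finite \<W> \<and> \<W> \<noteq> {} \<and>
          (\<forall>W\<in>\<W>. subspace W \<and> W \<noteq> {0} \<and> W \<noteq> UNIV) \<and>
          (\<forall>\<gamma>\<in>\<Gamma>. (\<lambda>v. \<gamma> *v v) ` \<Union>\<W> \<subseteq> \<Union>\<W>))"

definition limit_set :: "(real ^ 'n ^ 'n) set \<Rightarrow> (real ^ 'n) set set" where
  "limit_set \<Gamma> = projective_space closure_of
     {direction v |v \<gamma>. \<gamma> \<in> \<Gamma> \<and> proximal \<gamma> \<and> dominant_eigenvector \<gamma> v}"

definition limit_cone :: "(real ^ 'n ^ 'n) set \<Rightarrow> (real ^ 'n) set" where
  "limit_cone \<Gamma> = {v. v \<noteq> 0 \<and> direction v \<in> limit_set \<Gamma>}"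

end

theory Submission
  imports Defs
begin

text \<open>
  Let \<open>S\<close> be the closure in \<open>V\<close> of the set of vectors whose class lies in \<open>\<Sigma>\<close>. It is closed, symmetric
  and \<open>\<Gamma>\<close>-invariant, and it contains arbitrarily small non-zero vectors. It has to be shown that \<open>S\<close>
  contains every line that is a limit of dominant lines. Since the lines contained in a closed set form
  a closed set of directions, it is enough to treat the dominant lines themselves.

  Let \<open>A\<close> be proximal and expanding, with dominant eigenvalue \<open>r\<close> and eigenvector \<open>v\<close>. Then
  \<open>r\<^sup>-\<^sup>n A\<^sup>n x\<close> converges to \<open>\<phi> x v\<close> for a linear functional \<open>\<phi>\<close> with \<open>\<phi> v = 1\<close> (\<open>dominant_projection\<close>).
  Applying powers of \<open>A\<close> to small vectors of \<open>S\<close>, after moving them off the kernel of \<open>\<phi>\<close> by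
  irreducibility, gives a non-zero \<open>t\<close> such that all the vectors \<open>(t / r\<^sup>j) v\<close> are in \<open>S\<close>. Such \<open>t\<close> may
  be multiplied by any coefficient \<open>\<phi> (h v)\<close> with \<open>h\<close> in \<open>\<Gamma>\<close>: apply \<open>A\<^sup>n\<close> to the vectors \<open>(t / r\<^sup>n) h v\<close>
  and pass to the limit.

  So the question is whether the coefficients, together with \<open>r\<close>, generate a dense group of moduli. If
  they did not, the moduli would be discrete. As \<open>\<phi> (h A\<^sup>n k v) / r\<^sup>n\<close> converges to
  \<open>\<phi> (h v) \<phi> (k v)\<close>, this sequence would have to be eventually constant whenever the limit is not \<open>0\<close>.
  It satisfies a linear recurrence, and running the recurrence backwards to \<open>n = 0\<close> gives
  \<open>\<phi> (h k v) = \<phi> (h v) \<phi> (k v)\<close>. Strong irreducibility does not allow this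
  (\<open>coefficient_not_multiplicative\<close>): the orbit of \<open>v\<close> is not contained in a union of two hyperplanes
  (\<open>orbit_avoids_finite_union\<close>), and the identity then makes the kernel of \<open>\<phi>\<close> an invariant hyperplane.
  Hence \<open>S\<close> contains the line of \<open>v\<close> (\<open>dominant_line_subset\<close>).

  Finally let \<open>h\<close> in \<open>\<Gamma>\<close> be any proximal element. Moving the line of \<open>v\<close> off the
  repelling hyperplane of \<open>h\<close> and applying powers of \<open>h\<close> shows that \<open>S\<close> contains the dominant line
  of \<open>h\<close> (\<open>all_dominant_lines_subset\<close>).
\<close>

section \<open>Multiple roots of the characteristic polynomial\<close>

lemma poly_det_map_const:
  "poly (det (map_matrix (\<lambda>a. [:a:]) B)) x = det (B :: 'a::comm_ring_1^'n^'n)"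
proof -
  have "poly (of_int k) x = (of_int k :: 'a)" for k
    by (metis of_int_poly poly_const_conv)
  then show ?thesis
    by (auto simp: det_def poly_sum poly_prod intro!: sum.cong prod.cong arg_cong2[where f = "(*)"])
qed

lemma mat_scalar_mult_vec: "mat c *v x = c *s (x :: 'a::comm_ring_1^'n)"
  by (simp add: vec_eq_iff matrix_vector_mult_def mat_def mult_delta_left)

text \<open>
  The case \<open>c = 0\<close> is a second independent eigenvector and \<open>c \<noteq> 0\<close> is a Jordan block: both force a
  double root. In a basis that starts with \<open>u\<close> and \<open>w\<close>, two rows of the transposed characteristic
  matrix are \<open>(X - l) u\<close> and \<open>(X - l) w - c u\<close>, and row operations pull two factors \<open>X - l\<close> out of the
  determinant. This yields the only facts about algebraic multiplicity used below: a simple root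
  has a one-dimensional eigenspace and no Jordan block.
\<close>

lemma double_root_charpoly:
  fixes A :: "'a::field^'n^'n"
  assumes u: "u \<noteq> 0" "A *v u = l *s u"
    and w: "A *v w = l *s w + c *s u" "\<And>a. w \<noteq> a *s u"
  shows "[:-l, 1:]^2 dvd charpoly A"
proof -
  obtain i where i: "u $ i \<noteq> 0" using u(1) by (auto simp: vec_eq_iff)
  \<comment> \<open>Normalising coordinate \<open>i\<close> of \<open>w\<close> to \<open>0\<close> makes it possible to complete \<open>u\<close> and \<open>w'\<close> to a basis by
    standard basis vectors, replacing those with the indices \<open>i\<close> and \<open>j\<close>.\<close>
  define w' where "w' = w - (w $ i / u $ i) *s u"
  have w'i: "w' $ i = 0" using i by (simp add: w'_def)
  have Aw': "A *v w' = l *s w' + c *s u"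
    unfolding w'_def matrix_vector_mult_diff_distrib vector_scalar_commute u(2) w(1)
    by (simp add: vec_eq_iff algebra_simps)
  have "w' \<noteq> 0" using w(2)[of "w $ i / u $ i"] by (auto simp: w'_def)
  then obtain j where j: "w' $ j \<noteq> 0" by (auto simp: vec_eq_iff)
  have ij: "i \<noteq> j" using j w'i by auto
  define B where "B = (\<chi> k. if k = i then u else if k = j then w' else axis k 1)"
  have detB: "det B \<noteq> 0"
  proof -
    have "x = 0" if "transpose B *v x = 0" for x
    proof -
      have e: "(\<Sum>k\<in>UNIV. B $ k $ m * x $ k) = 0" for m
        using that by (auto simp: vec_eq_iff matrix_vector_mult_def transpose_def)
      have split: "(\<Sum>k\<in>UNIV. B $ k $ m * x $ k) =
          u $ m * x $ i + w' $ m * x $ j + (if m = i \<or> m = j then 0 else x $ m)" for m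
      proof -
        have "(\<Sum>k\<in>UNIV. B $ k $ m * x $ k) = (\<Sum>k\<in>UNIV. (if k = i then u $ m * x $ i else 0) +
          (if k = j then w' $ m * x $ j else 0) + (if k = m then (if m = i \<or> m = j then 0 else x $ m) else 0))"
          by (intro sum.cong) (auto simp: B_def axis_def ij)
        then show ?thesis by (simp add: sum.distrib)
      qed
      have xi: "x $ i = 0" using e[of i] split[of i] i w'i by simp
      have xj: "x $ j = 0" using e[of j] split[of j] j xi by simp
      show ?thesis using e split xi xj by (auto simp: vec_eq_iff) (metis add_0 mult_zero_right)
    qed
    then have "invertible (transpose B)"
      by (simp add: invertible_left_inverse matrix_left_invertible_ker)
    then show ?thesis by (simp add: invertible_det_nz)
  qed
  \<comment> \<open>From here on matrices have polynomial entries; \<open>M\<close> is the characteristic matrix, and row \<open>k\<close> of \<open>R\<close>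
    is \<open>M\<close> applied to the \<open>k\<close>-th basis vector.\<close>
  define C where "C = (\<lambda>v :: 'a^'n. \<chi> k. [:v $ k:])"
  define M where "M = mat [:0, 1:] - map_matrix (\<lambda>a. [:a:]) A"
  define B' where "B' = map_matrix (\<lambda>a. [:a:]) B"
  have const_sum: "(\<Sum>k\<in>S. [:f k:]) = [:\<Sum>k\<in>S. f k:]" for f :: "'n \<Rightarrow> 'a" and S
    by (induction S rule: infinite_finite_induct) auto
  have MC: "M *v C v = [:0, 1:] *s C v - C (A *v v)" for v
    by (simp add: M_def matrix_vector_mult_diff_rdistrib mat_scalar_mult_vec)
       (simp add: vec_eq_iff matrix_vector_mult_def C_def const_sum mult.commute)
  have MCu: "M *v C u = [:-l, 1:] *s C u"
    unfolding MC u(2) by (simp add: vec_eq_iff C_def)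
  have MCw: "M *v C w' = [:-l, 1:] *s C w' + [:-c:] *s C u"
    unfolding MC Aw' by (simp add: vec_eq_iff C_def)
  define R where "R = B' ** transpose M"
  have Rk: "R $ k = M *v (B' $ k)" for k
    by (simp add: R_def vec_eq_iff matrix_matrix_mult_def matrix_vector_mult_def transpose_def mult.commute)
  have Bk: "B' $ k = C (B $ k)" for k by (simp add: B'_def C_def vec_eq_iff)
  have "R = (\<chi> k. if k = i then [:-l, 1:] *s C u else R $ k)"
    using MCu by (simp add: vec_eq_iff Rk Bk B_def)
  then have "det R = [:-l, 1:] * det (\<chi> k. if k = i then C u else R $ k)"
    using det_row_mul[of i "[:-l, 1:]" "\<lambda>_. C u" "\<lambda>k. R $ k"] by simp
  also have "(\<chi> k. if k = i then C u else R $ k) =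
     (\<chi> k. if k = j then [:-l, 1:] *s C w' + [:-c:] *s C u else if k = i then C u else R $ k)"
    using MCw ij by (simp add: vec_eq_iff Rk Bk B_def)
  also have "det \<dots> = [:-l, 1:] * det (\<chi> k. if k = j then C w' else if k = i then C u else R $ k) + 
      [:-c:] * det (\<chi> k. if k = j then C u else if k = i then C u else R $ k)"
    unfolding det_row_add det_row_mul ..
  also have "det (\<chi> k. if k = j then C u else if k = i then C u else R $ k) = 0"
    by (rule det_identical_rows[OF ij]) (use ij in \<open>simp add: row_def\<close>)
  finally have "det R = [:-l, 1:]^2 * det (\<chi> k. if k = j then C w' else if k = i then C u else R $ k)"
    by (simp only: power2_eq_square mult.assoc mult_zero_right add_0_right)
  then have "[:-l, 1:]^2 dvd det R" by (rule dvdI)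
  then have dvd: "[:-l, 1:]^2 dvd det B' * charpoly A"
    by (simp add: R_def det_mul M_def charpoly_def)
  show ?thesis
  proof (cases "charpoly A = 0")
    case False
    have "poly (det B') l \<noteq> 0" using detB by (simp add: B'_def poly_det_map_const)
    then have "det B' \<noteq> 0" "order l (det B') = 0" by (auto simp: order_root)
    with dvd False have "2 \<le> order l (charpoly A)"
      by (simp add: order_divides order_mult)
    then show ?thesis by (simp add: order_divides)
  qed simp
qed

lemma eigenvalue_of_charpoly:
  fixes A :: "'a::field^'n^'n"
  shows "poly (charpoly A) l = 0 \<longleftrightarrow> (\<exists>v. v \<noteq> 0 \<and> A *v v = l *s v)"
proof -
  have "poly (charpoly A) l = 0 \<longleftrightarrow> \<not> invertible (mat l - A)"
    by (simp add: poly_charpoly invertible_det_nz)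
  also have "\<dots> \<longleftrightarrow> (\<exists>v. v \<noteq> 0 \<and> (mat l - A) *v v = 0)"
    by (auto simp: invertible_left_inverse matrix_left_invertible_ker)
  also have "(mat l - A) *v v = l *s v - A *v v" for v
    by (simp add: matrix_vector_mult_diff_rdistrib mat_scalar_mult_vec)
  then have "(\<exists>v. v \<noteq> 0 \<and> (mat l - A) *v v = 0) \<longleftrightarrow> (\<exists>v. v \<noteq> 0 \<and> A *v v = l *s v)" by auto
  finally show ?thesis .
qed

section \<open>Vectors annihilated by a product of linear factors\<close>

text \<open>
  The polynomial with the roots \<open>ms\<close>, evaluated at \<open>A\<close>, annihilates \<open>x\<close>; this form avoids products of
  matrices and allows induction on the roots.
\<close>

fun kills :: "'a::field^'n^'n \<Rightarrow> 'a list \<Rightarrow> 'a^'n \<Rightarrow> bool" where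
  "kills A [] x \<longleftrightarrow> x = 0"
| "kills A (m # ms) x \<longleftrightarrow> kills A ms (A *v x - m *s x)"

lemma kills_diff: "kills A ms x \<Longrightarrow> kills A ms y \<Longrightarrow> kills A ms (x - y)"
proof (induction ms arbitrary: x y)
  case (Cons m ms)
  have "A *v (x - y) - m *s (x - y) = (A *v x - m *s x) - (A *v y - m *s y)"
    by (simp add: matrix_vector_mult_diff_distrib vec_eq_iff algebra_simps)
  then show ?case using Cons by (simp only: kills.simps)
qed simp

lemma kills_scale: "kills A ms x \<Longrightarrow> kills A ms (c *s x)"
proof (induction ms arbitrary: x)
  case (Cons m ms)
  have "A *v (c *s x) - m *s (c *s x) = c *s (A *v x - m *s x)"
    by (simp add: vector_scalar_commute vec_eq_iff algebra_simps)
  then show ?case using Cons by (simp only: kills.simps)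
qed simp

lemma kills_mult: "kills A ms x \<Longrightarrow> kills A ms (A *v x)"
proof (induction ms arbitrary: x)
  case (Cons m ms)
  have "A *v (A *v x) - m *s (A *v x) = A *v (A *v x - m *s x)"
    by (simp add: matrix_vector_mult_diff_distrib vector_scalar_commute)
  then show ?case using Cons by simp
qed simp

lemma kills_cancel:
  assumes inj: "\<And>v. A *v v = m *s v \<Longrightarrow> v = 0" and "kills A ms (A *v x - m *s x)"
  shows "kills A ms x"
  using assms(2)
proof (induction ms arbitrary: x)
  case Nil
  then show ?case using inj by simp
next
  case (Cons k ms)
  have "A *v (A *v x - m *s x) - k *s (A *v x - m *s x) =
      A *v (A *v x - k *s x) - m *s (A *v x - k *s x)"
    by (simp only: matrix_vector_mult_diff_distrib vector_scalar_commute)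
       (simp add: vec.scale_right_diff_distrib mult.commute)
  with Cons.prems have "kills A ms (A *v (A *v x - k *s x) - m *s (A *v x - k *s x))"
    by simp
  then show ?case unfolding kills.simps by (rule Cons.IH)
qed

text \<open>
  \<open>A - l\<close> is invertible on the space annihilated by \<open>ms\<close>. In the inductive step, the solution \<open>v\<close> for
  \<open>(A - m) w\<close> gives \<open>(l - m) w = (A - l) (v - w)\<close>.
\<close>

lemma kills_solve:
  assumes "kills A ms w" "l \<notin> set ms"
  shows "\<exists>z. kills A ms z \<and> A *v z - l *s z = w"
  using assms
proof (induction ms arbitrary: w)
  case Nil
  then show ?case by (intro exI[of _ 0]) simp
next
  case (Cons m ms)
  then obtain v where v: "kills A ms v" "A *v v - l *s v = A *v w - m *s w" by auto
  define z where "z = (1 / (l - m)) *s (v - w)"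
  have lm: "l - m \<noteq> 0" using Cons.prems(2) by auto
  have 1: "kills A ms (A *v v - m *s v)" using v(1) by (intro kills_diff kills_mult kills_scale)
  have "A *v z - m *s z = (1 / (l - m)) *s ((A *v v - m *s v) - (A *v w - m *s w))"
    by (simp add: z_def vector_scalar_commute matrix_vector_mult_diff_distrib vec_eq_iff algebra_simps)
  moreover have "kills A ms (A *v w - m *s w)" using Cons.prems(1) by simp
  ultimately have k: "kills A (m # ms) z"
    unfolding kills.simps by (metis 1 kills_diff kills_scale)
  have "A *v z - l *s z = (1 / (l - m)) *s ((A *v v - l *s v) - (A *v w - l *s w))"
    by (simp add: z_def vector_scalar_commute matrix_vector_mult_diff_distrib vec_eq_iff algebra_simps)
  also have "\<dots> = (1 / (l - m)) *s ((l - m) *s w)"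
    unfolding v(2) by (simp add: vec_eq_iff algebra_simps)
  also have "\<dots> = w" using lm by (simp only: vector_smult_assoc) simp
  finally show ?case using k by blast
qed

text \<open>
  The list consists of the roots of \<open>p\<close>, split off one at a time by the fundamental theorem of algebra.
\<close>

lemma kills_exists_of_poly:
  fixes A :: "complex^'n^'n"
  assumes "p \<noteq> 0" "degree p \<le> N" "(\<Sum>i\<le>N. coeff p i *s (((*v) A ^^ i) x)) = 0"
  shows "\<exists>ms. kills A ms x"
  using assms
proof (induction N arbitrary: p x)
  case 0
  then have "coeff p 0 \<noteq> 0" by (metis le_zero_eq leading_coeff_neq_0)
  with 0 show ?case by (intro exI[of _ "[]"]) simp
next
  case (Suc N)
  show ?case
  proof (cases "degree p = 0")
    case True
    have "coeff p (Suc i) = 0" for i using True by (simp add: coeff_eq_0)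
    then have "coeff p 0 *s x = 0" using Suc.prems(3) by (simp del: sum.atMost_Suc add: sum.atMost_Suc_shift)
    moreover have "coeff p 0 \<noteq> 0" using Suc.prems(1) True by (metis leading_coeff_neq_0)
    ultimately show ?thesis by (intro exI[of _ "[]"]) simp
  next
    case False
    then obtain z where "poly p z = 0"
      using fundamental_theorem_of_algebra[of p] constant_degree[of p] by auto
    then obtain q where q: "p = [:-z, 1:] * q" by (metis dvdE poly_eq_0_iff_dvd)
    have q0: "q \<noteq> 0" using q Suc.prems(1) by auto
    have "degree p = Suc (degree q)" using q0 unfolding q by (subst degree_mult_eq) auto
    then have dq: "degree q \<le> N" using Suc.prems(2) by simp
    then have cq: "coeff q (Suc N) = 0" by (simp add: coeff_eq_0)
    have pow: "((*v) A ^^ i) (A *v x - z *s x) = ((*v) A ^^ Suc i) x - z *s (((*v) A ^^ i) x)" for i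
      by (induction i) (simp_all add: matrix_vector_mult_diff_distrib vector_scalar_commute)
    have c0: "coeff p 0 = - z * coeff q 0" unfolding q by simp
    have cS: "coeff p (Suc i) = coeff q i - z * coeff q (Suc i)" for i unfolding q by simp
    let ?P = "\<lambda>i. ((*v) A ^^ i) x"
    have "0 = (\<Sum>i\<le>Suc N. coeff p i *s ?P i)" using Suc.prems(3) by simp
    also have "\<dots> = coeff p 0 *s x + (\<Sum>i\<le>N. (coeff q i - z * coeff q (Suc i)) *s ?P (Suc i))"
      by (simp only: sum.atMost_Suc_shift cS) simp
    also have "\<dots> = (\<Sum>i\<le>N. coeff q i *s ?P (Suc i)) -
        z *s (coeff q 0 *s x + (\<Sum>i\<le>N. coeff q (Suc i) *s ?P (Suc i)))"
      by (simp add: c0 vec_eq_iff algebra_simps sum_subtractf sum_distrib_left)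
    also have "coeff q 0 *s x + (\<Sum>i\<le>N. coeff q (Suc i) *s ?P (Suc i)) = (\<Sum>i\<le>Suc N. coeff q i *s ?P i)"
      by (simp only: sum.atMost_Suc_shift) simp
    also have "\<dots> = (\<Sum>i\<le>N. coeff q i *s ?P i)" using cq by simp
    also have "(\<Sum>i\<le>N. coeff q i *s ?P (Suc i)) - z *s (\<Sum>i\<le>N. coeff q i *s ?P i) =
        (\<Sum>i\<le>N. coeff q i *s (((*v) A ^^ i) (A *v x - z *s x)))"
      unfolding pow by (simp add: vec_eq_iff algebra_simps sum_subtractf sum_distrib_left)
    finally obtain ms where "kills A ms (A *v x - z *s x)"
      using Suc.IH[OF q0 dq] by metis
    then show ?thesis by (intro exI[of _ "z # ms"]) simp
  qed
qed

text \<open>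
  The vectors \<open>x, A x, A\<^sup>2 x, \<dots>\<close> are linearly dependent, so some non-zero polynomial in \<open>A\<close> annihilates \<open>x\<close>.
\<close>

lemma kills_exists:
  fixes A :: "complex^'n^'n"
  shows "\<exists>ms. kills A ms x"
proof -
  let ?P = "\<lambda>i. ((*v) A ^^ i) x"
  have "\<exists>k. ?P k \<in> vec.span (?P ` {..<k})"
  proof (rule ccontr)
    assume neg: "\<not> ?thesis"
    have "vec.independent (?P ` {..<k}) \<and> card (?P ` {..<k}) = k" for k
    proof (induction k)
      case 0
      show ?case using vec.independent_empty by simp
    next
      case (Suc k)
      have n: "?P k \<notin> vec.span (?P ` {..<k})" using neg by blast
      then have "?P k \<notin> ?P ` {..<k}" using vec.span_base[of "?P k" "?P ` {..<k}"] by argo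
      then have "card (insert (?P k) (?P ` {..<k})) = Suc k"
        using Suc by (subst card_insert_disjoint) auto
      moreover have "vec.independent (insert (?P k) (?P ` {..<k}))"
        using Suc by (intro vec.independent_insertI[OF n]) simp
      ultimately show ?case unfolding lessThan_Suc image_insert by blast
    qed
    then have "k \<le> vec.dim (UNIV :: (complex^'n) set)" for k
      using vec.independent_card_le_dim[OF subset_UNIV, of "?P ` {..<k}"] by auto
    from this[of "Suc CARD('n)"] show False unfolding vec_dim_card by linarith
  qed
  then obtain k where "?P k \<in> vec.span (?P ` {..<k})" ..
  moreover define k' where "k' = (LEAST k. ?P k \<in> vec.span (?P ` {..<k}))"
  ultimately have k': "?P k' \<in> vec.span (?P ` {..<k'})" by (simp only: LeastI[of "\<lambda>k. ?P k \<in> vec.span (?P ` {..<k})"])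
  have inj: "inj_on ?P {..<k'}"
  proof (rule linorder_inj_onI')
    fix i j assume "i \<in> {..<k'}" "j \<in> {..<k'}" "i < j"
    then have "?P j \<notin> vec.span (?P ` {..<j})"
      using not_less_Least[of j "\<lambda>k. ?P k \<in> vec.span (?P ` {..<k})"] unfolding k'_def by simp
    moreover have "?P i \<in> vec.span (?P ` {..<j})" using \<open>i < j\<close> by (intro vec.span_base) simp
    ultimately show "?P i \<noteq> ?P j" by metis
  qed
  obtain c where c: "?P k' = (\<Sum>v\<in>?P ` {..<k'}. c v *s v)"
    using k' vec.span_finite[of "?P ` {..<k'}"] by fastforce
  have c': "?P k' = (\<Sum>i<k'. c (?P i) *s ?P i)" unfolding c using inj by (simp add: sum.reindex)
  define p where "p = monom 1 k' - (\<Sum>i<k'. monom (c (?P i)) i)"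
  have cp: "coeff p i = (if i = k' then 1 else if i < k' then - c (?P i) else 0)" for i
    by (auto simp: p_def coeff_sum)
  have "p \<noteq> 0" using cp[of k'] by auto
  moreover have "degree p \<le> k'" by (rule degree_le) (simp add: cp)
  moreover have "(\<Sum>i\<le>k'. coeff p i *s ?P i) = 0"
  proof -
    have "(\<Sum>i\<le>k'. coeff p i *s ?P i) = (\<Sum>i<k'. coeff p i *s ?P i) + ?P k'"
      by (simp add: lessThan_Suc_atMost[symmetric] cp)
    also have "(\<Sum>i<k'. coeff p i *s ?P i) = - (\<Sum>i<k'. c (?P i) *s ?P i)"
      by (simp add: cp sum_negf[symmetric])
    finally show ?thesis using c' by simp
  qed
  ultimately show ?thesis by (rule kills_exists_of_poly)
qed

section \<open>The projection onto a dominant eigenvector\<close>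

lemma norm_vector_scale: "norm (c *s x) = cmod c * norm (x :: complex^'n)"
  by (simp add: norm_vec_def norm_mult L2_set_def power_mult_distrib
      sum_distrib_left[symmetric] real_sqrt_mult)

lemma perturbed_contraction_tendsto_0:
  fixes b d :: "nat \<Rightarrow> real"
  assumes "0 \<le> q" "q < 1" and b: "\<And>n. 0 \<le> b n" "\<And>n. b (Suc n) \<le> q * b n + d n"
    and d: "d \<longlonglongrightarrow> 0"
  shows "b \<longlonglongrightarrow> 0"
proof (rule LIMSEQ_I)
  fix e :: real assume e: "0 < e"
  have "eventually (\<lambda>n. d n < e / 2 * (1 - q)) sequentially"
    using order_tendstoD(2)[OF d, of "e / 2 * (1 - q)"] e assms(2) by simp
  then obtain N where N: "\<And>n. n \<ge> N \<Longrightarrow> d n < e / 2 * (1 - q)"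
    by (auto simp: eventually_sequentially)
  have bound: "b (N + k) \<le> e / 2 + q ^ k * b N" for k
  proof (induction k)
    case (Suc k)
    have "b (N + Suc k) \<le> q * b (N + k) + d (N + k)" using b(2)[of "N + k"] by simp
    also have "\<dots> \<le> q * (e / 2 + q ^ k * b N) + e / 2 * (1 - q)"
      using Suc N[of "N + k"] assms(1) by (intro add_mono mult_left_mono) auto
    also have "\<dots> = e / 2 + q ^ Suc k * b N" by (simp add: field_simps)
    finally show ?case .
  qed (use e in simp)
  have "(\<lambda>k. q ^ k * b N) \<longlonglongrightarrow> 0"
    using LIMSEQ_realpow_zero[OF assms(1,2)] tendsto_mult_left_zero by blast
  then obtain K where K: "\<And>k. k \<ge> K \<Longrightarrow> q ^ k * b N < e / 2"
    using order_tendstoD(2)[of _ 0 sequentially "e / 2"] e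
    by (auto simp: eventually_sequentially)
  show "\<exists>no. \<forall>n\<ge>no. norm (b n - 0) < e"
  proof (intro exI[of _ "N + K"] allI impI)
    fix n assume "n \<ge> N + K"
    then obtain k where "n = N + k" "k \<ge> K" by (metis add.assoc le_add1 le_Suc_ex)
    then show "norm (b n - 0) < e" using bound[of k] K[of k] b(1)[of n] by simp
  qed
qed

text \<open>
  If \<open>z = A y - m y\<close>, then \<open>A\<^sup>n\<^sup>+\<^sup>1 y = m A\<^sup>n y + A\<^sup>n z\<close>: after division by powers of \<open>R\<close>, the norms
  satisfy a contracting recursion whose perturbation tends to \<open>0\<close> by induction on \<open>ms\<close>.
\<close>

lemma kills_decay:
  fixes A :: "complex^'n^'n"
  assumes "kills A ms y" "\<forall>m\<in>set ms. cmod m < R" "0 < R"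
  shows "(\<lambda>n. norm (((*v) A ^^ n) y) / R ^ n) \<longlonglongrightarrow> 0"
  using assms(1,2)
proof (induction ms arbitrary: y)
  case Nil
  have "((*v) A ^^ n) 0 = 0" for n by (induction n) simp_all
  then show ?case using Nil by simp
next
  case (Cons m ms)
  let ?z = "A *v y - m *s y"
  have IH: "(\<lambda>n. norm (((*v) A ^^ n) ?z) / R ^ n) \<longlonglongrightarrow> 0" using Cons by simp
  have pow: "((*v) A ^^ n) ?z = ((*v) A ^^ Suc n) y - m *s (((*v) A ^^ n) y)" for n
    by (induction n) (simp_all add: matrix_vector_mult_diff_distrib vector_scalar_commute)
  show ?case
  proof (rule perturbed_contraction_tendsto_0)
    show "0 \<le> cmod m / R" "cmod m / R < 1" using Cons.prems(2) \<open>0 < R\<close> by auto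
    show "0 \<le> norm (((*v) A ^^ n) y) / R ^ n" for n using \<open>0 < R\<close> by simp
    show "norm (((*v) A ^^ Suc n) y) / R ^ Suc n
        \<le> cmod m / R * (norm (((*v) A ^^ n) y) / R ^ n) + norm (((*v) A ^^ n) ?z) / R ^ n / R" for n
    proof -
      have "((*v) A ^^ Suc n) y = m *s (((*v) A ^^ n) y) + ((*v) A ^^ n) ?z"
        unfolding pow by simp
      then have "norm (((*v) A ^^ Suc n) y) \<le> cmod m * norm (((*v) A ^^ n) y) + norm (((*v) A ^^ n) ?z)"
        by (metis norm_triangle_ineq norm_vector_scale)
      from divide_right_mono[OF this, of "R ^ Suc n"] show ?thesis
        using \<open>0 < R\<close> by (simp add: add_divide_distrib mult.commute)
    qed
    show "(\<lambda>n. norm (((*v) A ^^ n) ?z) / R ^ n / R) \<longlonglongrightarrow> 0"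
      using tendsto_divide_zero[OF IH] .
  qed
qed

text \<open>
  This splits \<open>x\<close> along the eigenspace of \<open>l\<close> and the generalised eigenspaces of smaller modulus. Start
  from any list that annihilates \<open>x\<close> and treat its entries one by one: an entry that is no eigenvalue
  can be dropped, an entry of smaller modulus is kept, and an entry equal to \<open>l\<close> can be absorbed in the
  eigenvector because there is no Jordan block.
\<close>

lemma dominant_splitting:
  fixes A :: "complex^'n^'n"
  assumes ev: "\<And>m. poly (charpoly A) m = 0 \<Longrightarrow> m = l \<or> cmod m < cmod l"
    and simple: "\<not> [:-l, 1:]^2 dvd charpoly A"
  shows "\<exists>u w ms. x = u + w \<and> A *v u = l *s u \<and> kills A ms w \<and> (\<forall>m\<in>set ms. cmod m < cmod l)"
proof -
  obtain ms where "kills A ms x" using kills_exists by blast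
  then show ?thesis
  proof (induction ms arbitrary: x)
    case Nil
    then show ?case by (intro exI[of _ 0] exI[of _ "[]"]) simp
  next
    case (Cons m ms)
    then obtain u w ks where uw: "A *v x - m *s x = u + w" "A *v u = l *s u" "kills A ks w"
      "\<forall>k\<in>set ks. cmod k < cmod l" by (meson kills.simps(2))
    show ?case
    proof (cases "m = l")
      case True
      have "l \<notin> set ks" using uw(4) by auto
      then obtain z where z: "kills A ks z" "A *v z - l *s z = w" using kills_solve uw(3) by blast
      have *: "A *v (x - z) = l *s (x - z) + 1 *s u"
        using uw(1) z(2) True by (simp add: matrix_vector_mult_diff_distrib vec.scale_right_diff_distrib algebra_simps)
      have "u = 0"
      proof (rule ccontr)
        assume "u \<noteq> 0"
        then obtain a where "x - z = a *s u"
          using double_root_charpoly[OF _ uw(2) *] simple by blast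
        then have "A *v (x - z) = l *s (x - z)"
          by (simp add: vector_scalar_commute uw(2) mult.commute)
        with * \<open>u \<noteq> 0\<close> show False by simp
      qed
      then have "A *v (x - z) = l *s (x - z)" using * by simp
      then show ?thesis using z(1) uw(4) by (intro exI[of _ "x - z"] exI[of _ z] exI[of _ ks]) auto
    next
      case False
      define u' where "u' = (1 / (l - m)) *s u"
      have u': "A *v u' = l *s u'" by (simp add: u'_def vector_scalar_commute uw(2) mult.commute)
      have "l *s u' - m *s u' = u" using False
        by (simp only: u'_def vec.scale_left_diff_distrib[symmetric] vector_smult_assoc) (simp add: vec.scale_left_diff_distrib[symmetric] diff_divide_distrib[symmetric] del: vec.scale_left_diff_distrib)
      then have w: "A *v (x - u') - m *s (x - u') = w"
        using uw(1) u' by (simp add: matrix_vector_mult_diff_distrib vec.scale_right_diff_distrib algebra_simps)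
      have "\<exists>js. kills A js (x - u') \<and> (\<forall>k\<in>set js. cmod k < cmod l)"
      proof (cases "cmod m < cmod l")
        case True
        then show ?thesis using w uw(3,4) by (intro exI[of _ "m # ks"]) simp
      next
        case mod: False
        have "v = 0" if "A *v v = m *s v" for v
          using ev[of m] eigenvalue_of_charpoly[of A m] False mod that by blast
        then have "kills A ks (x - u')" using kills_cancel w uw(3) by metis
        then show ?thesis using uw(4) by blast
      qed
      then show ?thesis using u' by (metis add_diff_cancel_left' diff_add_cancel add.commute)
    qed
  qed
qed

lemma dominant_convergence:
  fixes A :: "complex^'n^'n"
  assumes ev: "\<And>m. poly (charpoly A) m = 0 \<Longrightarrow> m = l \<or> cmod m < cmod l"
    and simple: "\<not> [:-l, 1:]^2 dvd charpoly A" and "l \<noteq> 0"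
  shows "\<exists>u. A *v u = l *s u \<and> (\<lambda>n. (1 / l ^ n) *s (((*v) A ^^ n) x)) \<longlonglongrightarrow> u"
proof -
  obtain u w ms where uw: "x = u + w" "A *v u = l *s u" "kills A ms w" "\<forall>m\<in>set ms. cmod m < cmod l"
    using dominant_splitting[OF ev simple] by metis
  have "((*v) A ^^ n) x = l ^ n *s u + ((*v) A ^^ n) w" for n
    by (induction n) (simp_all add: uw(1,2) vec.add vector_scalar_commute mult.commute)
  then have "(1 / l ^ n) *s (((*v) A ^^ n) x) - u = (1 / l ^ n) *s (((*v) A ^^ n) w)" for n
    using \<open>l \<noteq> 0\<close> by (simp add: vec.scale_right_distrib)
  then have "norm ((1 / l ^ n) *s (((*v) A ^^ n) x) - u) = norm (((*v) A ^^ n) w) / cmod l ^ n" for n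
    by (simp add: norm_vector_scale norm_divide norm_power)
  then have "(\<lambda>n. norm ((1 / l ^ n) *s (((*v) A ^^ n) x) - u)) \<longlonglongrightarrow> 0"
    using kills_decay[OF uw(3,4)] \<open>l \<noteq> 0\<close> by simp
  then have "(\<lambda>n. (1 / l ^ n) *s (((*v) A ^^ n) x)) \<longlonglongrightarrow> u"
    unfolding tendsto_dist_iff[of _ u] dist_norm .
  then show ?thesis using uw(2) by blast
qed

lemma dominant_eigenvalueD:
  assumes "dominant_eigenvalue A l"
  defines "p \<equiv> charpoly (map_matrix complex_of_real A)"
  shows "p \<noteq> 0" "poly p l = 0" "\<not> [:-l, 1:]^2 dvd p"
    and "poly p m = 0 \<Longrightarrow> m = l \<or> cmod m < cmod l"
proof -
  have l: "l \<in># proots p" and m: "\<And>m. m \<in># proots p - {#l#} \<Longrightarrow> cmod m < cmod l"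
    using assms(1) by (auto simp: dominant_eigenvalue_def eigenvalues_def p_def)
  show p: "p \<noteq> 0" using l by auto
  then show "poly p l = 0" using l by simp
  have "l \<notin># proots p - {#l#}" using m[of l] by blast
  then have "order l p < 2" using p by (simp add: not_in_iff)
  then show "\<not> [:-l, 1:]^2 dvd p" using p by (simp add: order_divides)
  assume "poly p m = 0"
  then have "m \<in># proots p" using p by simp
  then show "m = l \<or> cmod m < cmod l" using m[of m] by (metis insert_DiffM insert_noteq_member l)
qed

lemma linear_matrix_iterate: "linear ((*v) (A :: real^'n^'n) ^^ n)"
proof (induction n)
  case (Suc n)
  then show ?case using linear_compose[of "(*v) A ^^ n" "(*v) A"] by (simp only: funpow.simps matrix_vector_mul_linear)
qed (simp add: linear_iff)

text \<open>
  The dominant eigenvalue is real since its conjugate is an eigenvalue of the same modulus. The limit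
  of \<open>r\<^sup>-\<^sup>n A\<^sup>n x\<close> exists and is an eigenvector for \<open>r\<close>; the eigenspace being a line, it is a multiple of
  \<open>v\<close>, and the coefficient is the dominant functional \<open>\<phi>\<close>, whose kernel is the repelling hyperplane.
\<close>

lemma dominant_projection:
  fixes A :: "real^'n^'n"
  assumes inv: "invertible A" and dom: "dominant_eigenvalue A l"
  obtains r v \<phi> where "l = complex_of_real r" "r \<noteq> 0" "linear \<phi>" "\<phi> v = 1" "A *v v = r *\<^sub>R v"
    "\<forall>x. (\<lambda>n. (1 / r ^ n) *\<^sub>R ((*v) A ^^ n) x) \<longlonglongrightarrow> \<phi> x *\<^sub>R v"
proof -
  define Ac where "Ac = map_matrix complex_of_real A"
  define cx where "cx = (\<lambda>x :: real^'n. \<chi> i. complex_of_real (x $ i))"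
  define re where "re = (\<lambda>z :: complex^'n. \<chi> i. Re (z $ i))"
  define im where "im = (\<lambda>z :: complex^'n. \<chi> i. Im (z $ i))"
  note D = dominant_eigenvalueD[OF dom, folded Ac_def]
  have Ac_cx: "Ac *v cx x = cx (A *v x)" for x
    by (simp add: Ac_def cx_def vec_eq_iff matrix_vector_mult_def)
  have re_Ac: "re (Ac *v z) = A *v re z" and im_Ac: "im (Ac *v z) = A *v im z" for z
    by (simp_all add: Ac_def re_def im_def vec_eq_iff matrix_vector_mult_def)
  obtain z where z: "z \<noteq> 0" "Ac *v z = l *s z"
    using D(2) eigenvalue_of_charpoly by blast
  have "cnj l = l"
  proof -
    define z' where "z' = (\<chi> i. cnj (z $ i))"
    have "Ac *v z' = cnj l *s z'"
    proof -
      have "(\<Sum>j\<in>UNIV. of_real (A $ i $ j) * cnj (z $ j)) = cnj (l * z $ i)" for i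
        using arg_cong[OF z(2), of "\<lambda>t. cnj (t $ i)"] by (simp add: Ac_def matrix_vector_mult_def)
      then show ?thesis by (simp add: vec_eq_iff Ac_def z'_def matrix_vector_mult_def)
    qed
    moreover have "z' \<noteq> 0" using z(1) by (simp add: vec_eq_iff z'_def)
    ultimately have "poly (charpoly Ac) (cnj l) = 0" using eigenvalue_of_charpoly by blast
    from D(4)[OF this] show ?thesis by simp
  qed
  then obtain r where r: "l = complex_of_real r" by (metis Reals_cnj_iff Reals_cases)
  have re_l: "re (l *s y) = r *\<^sub>R re y" and im_l: "im (l *s y) = r *\<^sub>R im y" for y
    by (simp_all add: re_def im_def r vec_eq_iff)
  obtain v where v: "v \<noteq> 0" "A *v v = r *\<^sub>R v"
  proof (cases "re z = 0")
    case True
    with z(1) have "im z \<noteq> 0" by (auto simp: re_def im_def vec_eq_iff complex_eq_iff)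
    moreover have "A *v im z = r *\<^sub>R im z" using im_Ac[of z] by (simp add: z(2) im_l)
    ultimately show ?thesis using that by blast
  next
    case False
    moreover have "A *v re z = r *\<^sub>R re z" using re_Ac[of z] by (simp add: z(2) re_l)
    ultimately show ?thesis using that by blast
  qed
  have r0: "r \<noteq> 0"
  proof
    assume "r = 0"
    with v have "A *v v = 0" by simp
    then show False using v(1) inv by (metis invertible_left_inverse matrix_left_invertible_ker)
  qed
  \<comment> \<open>Two independent real eigenvectors would stay independent over the complex numbers, giving a double
    root.\<close>
  have line: "\<exists>a. p = a *\<^sub>R v" if p: "A *v p = r *\<^sub>R p" for p
  proof (rule ccontr)
    assume neg: "\<not> ?thesis"
    obtain i where i: "v $ i \<noteq> 0" using v(1) by (auto simp: vec_eq_iff)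
    have "cx v \<noteq> 0" using v(1) by (simp add: cx_def vec_eq_iff)
    moreover have "Ac *v cx v = l *s cx v" "Ac *v cx p = l *s cx p + 0 *s cx v"
      by (simp_all add: Ac_cx v(2) p) (simp_all add: cx_def r vec_eq_iff)
    moreover have "cx p \<noteq> a *s cx v" for a
    proof
      assume eq: "cx p = a *s cx v"
      have comp: "complex_of_real (p $ j) = a * complex_of_real (v $ j)" for j
        using arg_cong[OF eq, of "\<lambda>t. t $ j"] by (simp add: cx_def)
      from comp[of i] have a: "a = complex_of_real (p $ i / v $ i)" using i by (simp add: field_simps)
      have "complex_of_real (p $ j) = complex_of_real (p $ i / v $ i * v $ j)" for j
        using comp[of j, unfolded a] by simp
      then have "p $ j = p $ i / v $ i * v $ j" for j unfolding of_real_eq_iff .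
      then have "p = (p $ i / v $ i) *\<^sub>R v"
        unfolding vec_eq_iff vector_scaleR_component real_scaleR_def by blast
      with neg show False by blast
    qed
    ultimately show False using double_root_charpoly[of "cx v" Ac l "cx p" 0] D(3) by metis
  qed
  let ?X = "\<lambda>x n. (1 / r ^ n) *\<^sub>R ((*v) A ^^ n) x"
  have "\<exists>p. A *v p = r *\<^sub>R p \<and> ?X x \<longlonglongrightarrow> p" for x
  proof -
    obtain u where u: "Ac *v u = l *s u" "(\<lambda>n. (1 / l ^ n) *s (((*v) Ac ^^ n) (cx x))) \<longlonglongrightarrow> u"
      using dominant_convergence[OF D(4) D(3)] r0 r by auto
    have it: "((*v) Ac ^^ n) (cx x) = cx (((*v) A ^^ n) x)" for n
      by (induction n) (simp_all add: Ac_cx)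
    have eq: "(1 / l ^ n) *s (((*v) Ac ^^ n) (cx x)) = cx (?X x n)" for n
      unfolding it by (simp add: cx_def r vec_eq_iff)
    have "?X x \<longlonglongrightarrow> re u"
    proof (rule vec_tendstoI)
      fix i
      have "(\<lambda>n. Re (cx (?X x n) $ i)) \<longlonglongrightarrow> Re (u $ i)"
        by (intro tendsto_Re tendsto_vec_nth u(2)[unfolded eq])
      then show "(\<lambda>n. ?X x n $ i) \<longlonglongrightarrow> re u $ i" by (simp add: cx_def re_def)
    qed
    moreover have "A *v re u = r *\<^sub>R re u" using re_Ac[of u] by (simp add: u(1) re_l)
    ultimately show ?thesis by blast
  qed
  then have "\<exists>P. \<forall>x. A *v P x = r *\<^sub>R P x \<and> ?X x \<longlonglongrightarrow> P x" by (intro choice allI)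
  then obtain P where P: "\<And>x. A *v P x = r *\<^sub>R P x" "\<And>x. ?X x \<longlonglongrightarrow> P x" by blast
  define \<phi> where "\<phi> = (\<lambda>x. (P x \<bullet> v) / (v \<bullet> v))"
  have P\<phi>: "P x = \<phi> x *\<^sub>R v" for x using line[OF P(1)[of x]] v(1) by (auto simp: \<phi>_def)
  have lin: "linear P"
  proof (rule linearI)
    fix x y
    have "?X (x + y) = (\<lambda>n. ?X x n + ?X y n)"
      by (simp add: linear_add[OF linear_matrix_iterate] scaleR_right_distrib)
    then have "?X (x + y) \<longlonglongrightarrow> P x + P y" using tendsto_add[OF P(2) P(2)] by (simp only:)
    then show "P (x + y) = P x + P y" by (rule LIMSEQ_unique[OF P(2)])
  next
    fix c x
    have "?X (c *\<^sub>R x) = (\<lambda>n. c *\<^sub>R ?X x n)"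
      by (simp add: linear_scale[OF linear_matrix_iterate])
    then have "?X (c *\<^sub>R x) \<longlonglongrightarrow> c *\<^sub>R P x"
      using tendsto_scaleR[OF tendsto_const P(2)] by (simp only:)
    then show "P (c *\<^sub>R x) = c *\<^sub>R P x" by (rule LIMSEQ_unique[OF P(2)])
  qed
  have "linear \<phi>" 
    by (rule linearI) (simp_all add: \<phi>_def linear_add[OF lin] linear_scale[OF lin] inner_left_distrib add_divide_distrib)
  moreover have "\<phi> v = 1"
  proof -
    have "((*v) A ^^ n) v = r ^ n *\<^sub>R v" for n
      by (induction n) (simp_all add: matrix_vector_mult_scaleR v(2))
    then have "?X v = (\<lambda>_. v)" using r0 by simp
    then have "?X v \<longlonglongrightarrow> v" by (simp only: tendsto_const)
    then have "P v = v" by (rule LIMSEQ_unique[OF P(2)])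
    then show ?thesis using v(1) by (simp add: \<phi>_def)
  qed
  ultimately show ?thesis using that[OF r r0] v(2) P(2) unfolding P\<phi> by blast
qed

lemma expanding_dominant:
  assumes "expanding A" "dominant_eigenvalue A l"
  shows "cmod l > 1"
proof -
  obtain m where m: "m \<in># eigenvalues A" "cmod m > 1" using assms(1) by (auto simp: expanding_def)
  then have "poly (charpoly (map_matrix complex_of_real A)) m = 0"
    using dominant_eigenvalueD(1)[OF assms(2)] by (simp add: eigenvalues_def)
  then show ?thesis using dominant_eigenvalueD(4)[OF assms(2)] m(2) by fastforce
qed

section \<open>Orbits of strongly irreducible semigroups\<close>

text \<open>
  Suppose that the orbit is covered by finitely many proper subspaces. Among all such covers minimise
  first the largest dimension \<open>k\<close> and then the number of subspaces of dimension \<open>k\<close>. Intersecting an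
  optimal cover with its preimage under \<open>\<gamma>\<close> gives another cover of the orbit, so by optimality every
  top-dimensional subspace is the preimage of a top-dimensional one. Hence the union of the
  top-dimensional subspaces is invariant, which contradicts strong irreducibility.
\<close>

lemma orbit_avoids_finite_union:
  fixes \<Gamma> :: "(real^'n^'n) set"
  assumes GL: "GL_subsemigroup \<Gamma>" and irr: "strongly_irreducible \<Gamma>" and ne: "\<Gamma> \<noteq> {}"
    and \<xi>: "\<xi> \<noteq> 0" and F: "finite F" "\<And>W. W \<in> F \<Longrightarrow> subspace W \<and> W \<noteq> UNIV"
  shows "\<exists>\<gamma>\<in>\<Gamma>. \<forall>W\<in>F. \<gamma> *v \<xi> \<notin> W"
proof (rule ccontr)
  assume neg: "\<not> ?thesis"
  have inj: "inj ((*v) \<gamma>)" if "\<gamma> \<in> \<Gamma>" for \<gamma>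
    using GL that by (auto simp: GL_subsemigroup_def inj_matrix_vector_mult)
  define Orb where "Orb = (\<lambda>\<gamma>. \<gamma> *v \<xi>) ` \<Gamma>"
  have Orb0: "x \<noteq> 0" if x: "x \<in> Orb" for x
  proof
    assume "x = 0"
    then obtain \<gamma> where \<gamma>: "\<gamma> \<in> \<Gamma>" "\<gamma> *v \<xi> = \<gamma> *v 0" using x by (auto simp: Orb_def)
    then show False using injD[OF inj[OF \<gamma>(1)] \<gamma>(2)] \<xi> by blast
  qed
  have Orb_inv: "\<gamma> *v x \<in> Orb" if "\<gamma> \<in> \<Gamma>" "x \<in> Orb" for \<gamma> x
    using GL that by (auto simp: Orb_def GL_subsemigroup_def matrix_vector_mul_assoc)
  define cover where "cover = (\<lambda>k F. finite F \<and> (\<forall>W\<in>F. subspace W \<and> dim W \<le> k) \<and> Orb \<subseteq> \<Union>F)"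
  define k where "k = (LEAST k. \<exists>F. cover k F)"
  have F_cover: "cover (DIM(real^'n) - 1) F"
  proof -
    have "dim W \<le> DIM(real^'n) - 1" if "W \<in> F" for W
    proof -
      have "span W \<noteq> UNIV" using F(2)[OF that] by (metis span_eq_iff)
      then have "dim W \<noteq> DIM(real^'n)" by (metis dim_eq_full)
      then show ?thesis using dim_subset_UNIV[of W] by linarith
    qed
    then show ?thesis using neg F unfolding cover_def Orb_def by blast
  qed
  have k_le: "k \<le> DIM(real^'n) - 1" unfolding k_def by (rule Least_le) (use F_cover in blast)
  have ex_k: "\<exists>F. cover k F" unfolding k_def by (rule LeastI_ex) (use F_cover in blast)
  have k_least: "k \<le> j" if "cover j G" for j G unfolding k_def by (rule Least_le) (use that in blast)
  define top where "top = (\<lambda>F :: (real^'n) set set. {W \<in> F. dim W = k})"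
  define m where "m = (LEAST m. \<exists>F. cover k F \<and> card (top F) = m)"
  have "\<exists>F. cover k F \<and> card (top F) = m" unfolding m_def by (rule LeastI_ex) (use ex_k in blast)
  then obtain T where T: "cover k T" "card (top T) = m" by blast
  have m_least: "m \<le> card (top G)" if "cover k G" for G
    unfolding m_def by (rule Least_le) (use that in blast)
  have k0: "k \<noteq> 0"
  proof
    assume "k = 0"
    with T(1) have "W \<subseteq> {0}" if "W \<in> T" for W using that by (simp add: cover_def dim_eq_0)
    then have "Orb \<subseteq> {0}" using T(1) unfolding cover_def by blast
    then show False using Orb0 ne unfolding Orb_def by blast
  qed
  have top_ne: "top T \<noteq> {}"
  proof
    assume "top T = {}"
    then have "dim W \<le> k - 1" if "W \<in> T" for W
      using T(1) that unfolding top_def cover_def by (metis (mono_tags, lifting) One_nat_def Suc_pred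
          empty_iff k0 le_eq_less_or_eq less_Suc_eq_le mem_Collect_eq not_gr_zero)
    then have "cover (k - 1) T" using T(1) unfolding cover_def by blast
    then show False using k_least k0 by fastforce
  qed
  have step: "(*v) \<gamma> ` W \<subseteq> \<Union>(top T)" if \<gamma>: "\<gamma> \<in> \<Gamma>" and W: "W \<in> top T" for \<gamma> W
  proof -
    define G where "G = (\<lambda>(A, B). A \<inter> (*v) \<gamma> -` B) ` (T \<times> T)"
    have sub: "subspace (A \<inter> (*v) \<gamma> -` B)" if "A \<in> T" "B \<in> T" for A B
      using T(1) that unfolding cover_def
      by (auto intro!: subspace_inter linear_subspace_vimage)
    have dims: "dim (A \<inter> (*v) \<gamma> -` B) \<le> dim A" for A B by (rule dim_subset) blast
    have coverG: "cover k G"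
    proof -
      have "Orb \<subseteq> \<Union>G"
      proof
        fix x assume x: "x \<in> Orb"
        then obtain A where A: "A \<in> T" "x \<in> A" using T(1) unfolding cover_def by blast
        obtain B where B: "B \<in> T" "\<gamma> *v x \<in> B" using T(1) Orb_inv[OF \<gamma> x] unfolding cover_def by blast
        show "x \<in> \<Union>G" unfolding G_def using A B by (intro UnionI[of "A \<inter> (*v) \<gamma> -` B"]) auto
      qed
      moreover have "dim C \<le> k" if C: "C \<in> G" for C
      proof -
        obtain A B where "A \<in> T" "C = A \<inter> (*v) \<gamma> -` B" using C by (auto simp: G_def)
        then show ?thesis using order_trans[OF dims[of A B], of k] T(1) unfolding cover_def by blast
      qed
      moreover have "subspace C" if "C \<in> G" for C using that sub unfolding G_def by auto
      moreover have "finite G" using T(1) unfolding G_def cover_def by blast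
      ultimately show ?thesis unfolding cover_def by blast
    qed
    have "top G \<subseteq> top T"
    proof
      fix C assume C: "C \<in> top G"
      then obtain A B where AB: "A \<in> T" "B \<in> T" "C = A \<inter> (*v) \<gamma> -` B" unfolding top_def G_def by blast
      have "dim A \<le> dim C" using C AB(1) T(1) unfolding top_def cover_def by simp
      then have "C = A" using AB sub[OF AB(1,2)] T(1) unfolding cover_def
        by (intro subspace_dim_equal) auto
      then show "C \<in> top T" using C AB(1) unfolding top_def by simp
    qed
    moreover have "finite (top T)" using T(1) unfolding top_def cover_def by simp
    ultimately have "top G = top T" using m_least[OF coverG] T(2) by (intro card_seteq) auto
    then have "W \<in> G" using W unfolding top_def by blast
    then obtain A B where AB: "B \<in> T" "W = A \<inter> (*v) \<gamma> -` B" by (auto simp: G_def)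
    have WB: "(*v) \<gamma> ` W \<subseteq> B" using AB(2) by blast
    have "k = dim ((*v) \<gamma> ` W)"
      using W dim_image_eq[of "(*v) \<gamma>" W] inj[OF \<gamma>] by (simp add: top_def inj_on_subset)
    also have "\<dots> \<le> dim B" using WB by (rule dim_subset)
    finally have "dim B = k" using AB(1) T(1) unfolding cover_def by (simp add: le_antisym)
    then show ?thesis using WB AB(1) unfolding top_def by blast
  qed
  have "subspace W \<and> W \<noteq> {0} \<and> W \<noteq> UNIV" if W: "W \<in> top T" for W
  proof (intro conjI)
    show "subspace W" using W T(1) unfolding top_def cover_def by blast
    show "W \<noteq> {0}" using W k0 unfolding top_def by auto
    have "k < DIM(real^'n)" using k_le k0 by linarith
    then show "W \<noteq> UNIV" using W unfolding top_def by auto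
  qed
  moreover have "finite (top T)" using T(1) unfolding top_def cover_def by simp
  moreover have "(\<lambda>v. \<gamma> *v v) ` \<Union>(top T) \<subseteq> \<Union>(top T)" if "\<gamma> \<in> \<Gamma>" for \<gamma> using step[OF that] by blast
  ultimately show False using irr top_ne unfolding strongly_irreducible_def by metis
qed

lemma proper_kernel:
  assumes "linear f" "f x \<noteq> (0::real)"
  shows "subspace {x. f x = 0} \<and> {x. f x = 0} \<noteq> UNIV"
  using assms linear_subspace_kernel by blast

lemma orbit_avoids_two_kernels:
  fixes \<Gamma> :: "(real^'n^'n) set" and f g :: "real^'n \<Rightarrow> real"
  assumes "GL_subsemigroup \<Gamma>" "strongly_irreducible \<Gamma>" "\<Gamma> \<noteq> {}" "\<xi> \<noteq> 0"
    and "linear f" "f x \<noteq> 0" "linear g" "g y \<noteq> 0"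
  shows "\<exists>\<gamma>\<in>\<Gamma>. f (\<gamma> *v \<xi>) \<noteq> 0 \<and> g (\<gamma> *v \<xi>) \<noteq> 0"
  using orbit_avoids_finite_union[OF assms(1-4), of "{{x. f x = 0}, {x. g x = 0}}"]
    proper_kernel[of f x] proper_kernel[of g y] assms(5-) by auto

text \<open>
  Suppose that \<open>h \<mapsto> \<phi> (h v)\<close> is multiplicative where it does not vanish. For fixed \<open>h\<close> with
  \<open>\<phi> (h v) \<noteq> 0\<close>, the orbit of \<open>v\<close> lies in the union of the kernels of \<open>\<phi>\<close> and of
  \<open>x \<mapsto> \<phi> (h x) - \<phi> (h v) \<phi> x\<close>, so the latter functional vanishes and the kernel of \<open>\<phi>\<close> is stable
  under \<open>h\<close>. A second application of the same principle shows that \<open>\<phi> (h v)\<close> never vanishes, so the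
  kernel of \<open>\<phi>\<close> is an invariant hyperplane, non-zero in dimension at least two.
\<close>

lemma coefficient_not_multiplicative:
  fixes \<Gamma> :: "(real^'n^'n) set"
  assumes card: "CARD('n) > 1" and GL: "GL_subsemigroup \<Gamma>" and irr: "strongly_irreducible \<Gamma>"
    and ne: "\<Gamma> \<noteq> {}" and \<phi>: "linear \<phi>" "\<phi> v = (1::real)"
  shows "\<exists>h\<in>\<Gamma>. \<exists>k\<in>\<Gamma>. \<phi> (h *v v) \<noteq> 0 \<and> \<phi> (k *v v) \<noteq> 0 \<and>
    \<phi> (h *v (k *v v)) \<noteq> \<phi> (h *v v) * \<phi> (k *v v)"
proof (rule ccontr)
  assume "\<not> ?thesis"
  then have mult: "\<phi> (h *v (k *v v)) = \<phi> (h *v v) * \<phi> (k *v v)"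
    if "h \<in> \<Gamma>" "k \<in> \<Gamma>" "\<phi> (h *v v) \<noteq> 0" "\<phi> (k *v v) \<noteq> 0" for h k using that by blast
  have v0: "v \<noteq> 0" using \<phi> linear_0 by fastforce
  note avoid = orbit_avoids_two_kernels[OF GL irr ne v0 \<phi>(1), of v]
  have lin: "linear (\<lambda>x. \<phi> (h *v x))" for h
    using linear_compose[OF matrix_vector_mul_linear \<phi>(1)] by (simp add: o_def)
  have eigen: "\<phi> (h *v x) = \<phi> (h *v v) * \<phi> x" if h: "h \<in> \<Gamma>" "\<phi> (h *v v) \<noteq> 0" for h x
  proof (rule ccontr)
    assume x: "\<phi> (h *v x) \<noteq> \<phi> (h *v v) * \<phi> x"
    have "linear (\<lambda>y. \<phi> (h *v y) - \<phi> (h *v v) * \<phi> y)"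
      by (intro linear_compose_sub lin linear_compose_scale_right[OF \<phi>(1), unfolded real_scaleR_def])
    then obtain k where "k \<in> \<Gamma>" "\<phi> (k *v v) \<noteq> 0" "\<phi> (h *v (k *v v)) - \<phi> (h *v v) * \<phi> (k *v v) \<noteq> 0"
      using avoid[of "\<lambda>y. \<phi> (h *v y) - \<phi> (h *v v) * \<phi> y" x] \<phi>(2) x by auto
    then show False using mult[OF h(1) _ h(2)] by simp
  qed
  have surj: "\<exists>x. h *v x = y" if "h \<in> \<Gamma>" for h y
    using GL that unfolding GL_subsemigroup_def
    by (metis matrix_right_invertible_surjective invertible_right_inverse surjD)
  have nonzero: "\<phi> (h *v v) \<noteq> 0" if h: "h \<in> \<Gamma>" for h
  proof
    assume hv: "\<phi> (h *v v) = 0"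
    obtain x where x: "h *v x = v" using surj[OF h] by blast
    obtain k where k: "k \<in> \<Gamma>" "\<phi> (k *v v) \<noteq> 0" "\<phi> (h *v (k *v v)) \<noteq> 0"
      using avoid[OF _ lin, of h x] \<phi>(2) x by auto
    have hk: "h ** k \<in> \<Gamma>" using GL h k(1) unfolding GL_subsemigroup_def by blast
    obtain y where y: "k *v y = v" using surj[OF k(1)] by blast
    have "\<phi> (k *v v) * \<phi> y = 1" using eigen[OF k(1,2), of y] y \<phi>(2) by simp
    moreover have "0 = \<phi> (h *v (k *v v)) * \<phi> y"
      using eigen[OF hk, of y] k(3) y hv by (simp add: matrix_vector_mul_assoc[symmetric])
    ultimately show False using k(3) by auto
  qed
  define H where "H = {x. \<phi> x = 0}"
  have "(\<lambda>x. h *v x) ` H \<subseteq> H" if h: "h \<in> \<Gamma>" for h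
  proof -
    have "\<phi> (h *v x) = 0" if "\<phi> x = 0" for x
      using eigen[OF h nonzero[OF h], of x] that by (simp only: mult_zero_right)
    then show ?thesis by (auto simp: H_def)
  qed
  moreover have "subspace H" "H \<noteq> UNIV" using proper_kernel[of \<phi> v] \<phi> by (auto simp: H_def)
  moreover have "H \<noteq> {0}"
  proof
    assume H: "H = {0}"
    have "x \<in> span {v}" for x
    proof -
      have "x - \<phi> x *\<^sub>R v \<in> H"
        using \<phi> by (simp add: H_def linear_diff linear_scale)
      then show ?thesis using H by (auto simp: span_singleton)
    qed
    then have "dim (UNIV :: (real^'n) set) \<le> card {v}" by (intro dim_le_card) auto
    then show False using card by simp
  qed
  ultimately have "\<exists>\<W>. finite \<W> \<and> \<W> \<noteq> {} \<and>
      (\<forall>W\<in>\<W>. subspace W \<and> W \<noteq> {0} \<and> W \<noteq> UNIV) \<and>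
      (\<forall>h\<in>\<Gamma>. (\<lambda>x. h *v x) ` \<Union>\<W> \<subseteq> \<Union>\<W>)"
    by (intro exI[of _ "{H}"]) simp
  then show False using irr unfolding strongly_irreducible_def by (rule notE[rotated])
qed

section \<open>Discreteness\<close>

text \<open>
  A linear recurrence with invertible matrix that is eventually \<open>0\<close> is \<open>0\<close> from the start: the space
  \<open>U k\<close> of the vectors for which it vanishes from \<open>k\<close> on contains \<open>U 0\<close> and is mapped injectively into
  \<open>U 0\<close> by \<open>A\<^sup>k\<close>.
\<close>

lemma vanishing_backwards:
  fixes A :: "real^'n^'n" and \<psi> :: "real^'n \<Rightarrow> real"
  assumes inv: "invertible A" and \<psi>: "linear \<psi>"
    and van: "\<And>n. n \<ge> k \<Longrightarrow> \<psi> (((*v) A ^^ n) y) = 0"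
  shows "\<psi> y = 0"
proof -
  define U where "U = (\<lambda>k. {y. \<forall>n\<ge>k. \<psi> (((*v) A ^^ n) y) = 0})"
  have sub: "subspace (U k)" for k
    unfolding subspace_def U_def
    by (auto simp: linear_0[OF linear_matrix_iterate] linear_add[OF linear_matrix_iterate]
        linear_scale[OF linear_matrix_iterate] linear_0[OF \<psi>] linear_add[OF \<psi>] linear_scale[OF \<psi>])
  have inj: "inj ((*v) A ^^ k)"
    using inv by (intro inj_fn) (simp add: inj_matrix_vector_mult)
  have "((*v) A ^^ k) ` U k \<subseteq> U 0"
    by (auto simp: U_def simp flip: funpow_add[THEN fun_cong, unfolded o_apply])
  then have "dim (U k) \<le> dim (U 0)"
    using dim_image_eq[OF linear_matrix_iterate, of k A "U k"] inj
    by (metis dim_subset inj_on_subset subset_UNIV)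
  moreover have "U 0 \<subseteq> U k" by (auto simp: U_def)
  ultimately have "U 0 = U k" using sub by (intro subspace_dim_equal) auto
  then have "y \<in> U 0" using van by (simp add: U_def)
  then have "\<psi> (((*v) A ^^ 0) y) = 0" unfolding U_def by blast
  then show ?thesis by simp
qed

text \<open>
  Modulo the period \<open>l\<close> this is a closed subsemigroup of a circle, hence a group: by Dirichlet
  approximation some multiple \<open>k b\<close> with \<open>k > 0\<close> is close to a multiple of \<open>l\<close>, so that \<open>(k - 1) b\<close> is
  close to \<open>- b\<close> modulo \<open>l\<close>. A closed subgroup of the reals with arbitrarily small non-zero elements is
  everything.
\<close>

lemma closed_semigroup_containing_period_is_discrete:
  fixes B :: "real set"
  assumes cl: "closed B" and add: "\<And>a b. a \<in> B \<Longrightarrow> b \<in> B \<Longrightarrow> a + b \<in> B"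
    and l: "0 < l" "l \<in> B" "- l \<in> B" and proper: "B \<noteq> UNIV"
  shows "\<exists>e>0. \<forall>a\<in>B. \<forall>b\<in>B. \<bar>a - b\<bar> < e \<longrightarrow> a = b"
proof -
  have B0: "0 \<in> B" using add[OF l(2,3)] by simp
  have mult: "of_nat n * b \<in> B" if "b \<in> B" for n b
  proof (induction n)
    case (Suc n)
    then show ?case using add[OF that] by (simp add: distrib_right)
  qed (use B0 in simp)
  have multl: "of_int j * l \<in> B" for j
    using mult[OF l(2), of "nat j"] mult[OF l(3), of "nat (- j)"] by (cases "j \<ge> 0") auto
  have approx: "x \<in> B" if "\<And>e. 0 < e \<Longrightarrow> \<exists>b\<in>B. \<bar>b - x\<bar> < e" for x
  proof -
    have "x \<in> closure B" using that by (simp add: closure_approachable dist_real_def)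
    then show ?thesis using cl by simp
  qed
  have neg: "- b \<in> B" if b: "b \<in> B" for b
  proof (rule approx)
    fix e :: real assume "0 < e"
    obtain N :: nat where N: "N > 0" "l / e < real N" 
      using reals_Archimedean2[of "l / e"] \<open>0 < l\<close> \<open>0 < e\<close> by (metis divide_pos_pos less_trans of_nat_0_less_iff)
    obtain h k where hk: "0 < k" "\<bar>of_int k * (b / l) - of_int h\<bar> < 1 / N"
      using Dirichlet_approx[OF N(1)] by metis
    have "\<bar>of_int k * b - of_int h * l\<bar> = \<bar>of_int k * (b / l) - of_int h\<bar> * l"
      using l(1) by (simp add: abs_mult[symmetric] field_simps abs_if)
    also have "\<dots> < 1 / N * l" using hk(2) l(1) by (intro mult_strict_right_mono)
    also have "\<dots> < e" using N \<open>0 < e\<close> by (simp add: field_simps)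
    finally have close: "\<bar>of_int k * b - of_int h * l\<bar> < e" .
    have "of_nat (nat (k - 1)) * b + of_int (- h) * l \<in> B" using mult[OF b] multl by (rule add)
    then have "of_int k * b - of_int h * l - b \<in> B" using hk(1) by (simp add: algebra_simps)
    then show "\<exists>c\<in>B. \<bar>c - - b\<bar> < e" using close by (intro bexI[of _ "of_int k * b - of_int h * l - b"]) auto
  qed
  show ?thesis
  proof (rule ccontr)
    assume "\<not> ?thesis"
    then have small: "\<exists>a\<in>B. \<exists>b\<in>B. \<bar>a - b\<bar> < e \<and> a \<noteq> b" if "0 < e" for e using that by blast
    have "y \<in> B" for y
    proof (rule approx)
      fix e :: real assume "0 < e"
      then obtain a b where ab: "a \<in> B" "b \<in> B" "\<bar>a - b\<bar> < e" "a \<noteq> b" using small by blast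
      define x where "x = \<bar>a - b\<bar>"
      have "a - b \<in> B" "b - a \<in> B" using add[OF ab(1) neg[OF ab(2)]] add[OF ab(2) neg[OF ab(1)]] by auto
      then have x: "x \<in> B" "0 < x" "x < e" using ab by (auto simp: x_def abs_if)
      define j where "j = \<lfloor>y / x\<rfloor>"
      have "of_int j * x \<in> B"
        using mult[OF x(1), of "nat j"] mult[OF neg[OF x(1)], of "nat (- j)"] by (cases "j \<ge> 0") auto
      moreover have "of_int j \<le> y / x" "y / x < of_int j + 1" unfolding j_def by linarith+
      then have "of_int j * x \<le> y" "y < of_int j * x + x"
        using x(2) by (simp_all add: field_simps)
      then have "\<bar>of_int j * x - y\<bar> < e" using x(3) by linarith
      ultimately show "\<exists>b\<in>B. \<bar>b - y\<bar> < e" by blast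
    qed
    then show False using proper by blast
  qed
qed

section \<open>Lines in closed invariant sets\<close>

text \<open>
  The points \<open>r\<^sup>-\<^sup>k z\<close> of \<open>S\<close> are sent by \<open>A\<^sup>k\<close> to \<open>r\<^sup>-\<^sup>k A\<^sup>k z\<close>, close to \<open>\<phi> \<zeta> v\<close>. Pointwise convergence of
  the linear maps \<open>r\<^sup>-\<^sup>k A\<^sup>k\<close> suffices although \<open>z\<close> varies, because \<open>z\<close> can be expanded in a basis.
\<close>

lemma renormalised_limit:
  fixes A :: "real^'n^'n"
  assumes conv: "\<And>x. (\<lambda>n. (1 / r ^ n) *\<^sub>R ((*v) A ^^ n) x) \<longlonglongrightarrow> \<phi> x *\<^sub>R v"
    and \<phi>: "linear \<phi>"
    and S: "closed S" "\<And>x. x \<in> S \<Longrightarrow> A *v x \<in> S"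
    and k: "filterlim k at_top sequentially" and z: "z \<longlonglongrightarrow> \<zeta>"
    and zS: "\<forall>\<^sub>F n in sequentially. (1 / r ^ k n) *\<^sub>R z n \<in> S"
  shows "\<phi> \<zeta> *\<^sub>R v \<in> S"
proof -
  let ?M = "\<lambda>n x. (1 / r ^ n) *\<^sub>R ((*v) A ^^ n) x"
  have lin: "linear (?M n)" for n
    by (intro linear_compose_scale_right linear_matrix_iterate)
  have expand: "?M n x = (\<Sum>b\<in>Basis. (x \<bullet> b) *\<^sub>R ?M n b)" for n x
    using linear_sum[OF lin, of n "\<lambda>b. (x \<bullet> b) *\<^sub>R b" Basis]
    by (simp only: euclidean_representation linear_scale[OF lin])
  have "(\<lambda>n. \<Sum>b\<in>Basis. (z n \<bullet> b) *\<^sub>R ?M (k n) b) \<longlonglongrightarrow> (\<Sum>b\<in>Basis. (\<zeta> \<bullet> b) *\<^sub>R (\<phi> b *\<^sub>R v))"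
    by (intro tendsto_sum tendsto_scaleR tendsto_inner z tendsto_const filterlim_compose[OF conv k])
  moreover have "(\<Sum>b\<in>Basis. (\<zeta> \<bullet> b) *\<^sub>R (\<phi> b *\<^sub>R v)) = \<phi> \<zeta> *\<^sub>R v"
  proof -
    have "\<phi> \<zeta> = (\<Sum>b\<in>Basis. (\<zeta> \<bullet> b) * \<phi> b)"
      using linear_sum[OF \<phi>, of "\<lambda>b. (\<zeta> \<bullet> b) *\<^sub>R b" Basis]
      by (simp only: euclidean_representation linear_scale[OF \<phi>] real_scaleR_def)
    then show ?thesis by (simp add: scaleR_sum_left)
  qed
  moreover have "(\<lambda>n. ?M (k n) (z n)) = (\<lambda>n. \<Sum>b\<in>Basis. (z n \<bullet> b) *\<^sub>R ?M (k n) b)"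
    by (intro ext expand)
  ultimately have "(\<lambda>n. ?M (k n) (z n)) \<longlonglongrightarrow> \<phi> \<zeta> *\<^sub>R v" by (simp only:)
  moreover have "((*v) A ^^ m) x \<in> S" if "x \<in> S" for m x
    using that by (induction m) (simp_all add: S(2))
  then have "\<forall>\<^sub>F n in sequentially. ?M (k n) (z n) \<in> S"
    using zS by (auto elim!: eventually_mono simp: linear_scale[OF linear_matrix_iterate, symmetric])
  ultimately show ?thesis using S(1) by (intro Lim_in_closed_set[of S "\<lambda>n. ?M (k n) (z n)" sequentially]) auto
qed

text \<open>
  A small vector \<open>x\<close> is multiplied by the power of \<open>r\<close> that moves it to the annulus of radii \<open>1\<close> and
  \<open>\<bar>r\<bar>\<close>; these powers tend to infinity and the annulus is compact.
\<close>

lemma rescale_small_vectors: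
  fixes S :: "'a::euclidean_space set"
  assumes r: "1 < \<bar>r :: real\<bar>" and S: "0 \<in> closure (S - {0})"
  obtains z \<zeta> k where "filterlim k at_top sequentially" "z \<longlonglongrightarrow> \<zeta>" "\<zeta> \<noteq> 0"
    "\<And>n. (1 / r ^ k n) *\<^sub>R z n \<in> S"
proof -
  have "\<exists>x k. x \<in> S \<and> n \<le> k \<and> 1 \<le> \<bar>r\<bar> ^ k * norm x \<and> \<bar>r\<bar> ^ k * norm x \<le> \<bar>r\<bar>" for n :: nat
  proof -
    \<comment> \<open>Choosing \<open>x\<close> shorter than \<open>1 / \<bar>r\<bar>\<^sup>n\<close> forces the exponent \<open>k\<close> to exceed \<open>n\<close>.\<close>
    have pos: "0 < 1 / \<bar>r\<bar> ^ n" using r by auto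
    then obtain x where x: "x \<in> S" "x \<noteq> 0" "norm x < 1 / \<bar>r\<bar> ^ n"
      using S unfolding closure_approachable by (metis Diff_iff dist_0_norm dist_commute insertI1)
    have small: "\<bar>r\<bar> ^ n * norm x < 1" using x(3) r by (simp add: field_simps)
    define k where "k = (LEAST k. 1 \<le> \<bar>r\<bar> ^ k * norm x)"
    obtain N where "1 / norm x < \<bar>r\<bar> ^ N" using real_arch_pow[OF r] by blast
    then have "1 \<le> \<bar>r\<bar> ^ N * norm x" using x(2) by (simp add: field_simps)
    then have k: "1 \<le> \<bar>r\<bar> ^ k * norm x" unfolding k_def by (rule LeastI)
    have "n < k"
    proof (rule ccontr)
      assume "\<not> n < k"
      then have "\<bar>r\<bar> ^ k * norm x \<le> \<bar>r\<bar> ^ n * norm x"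
        using r by (intro mult_right_mono power_increasing) auto
      then show False using k small by linarith
    qed
    then have kS: "k = Suc (k - 1)" by simp
    have "\<not> 1 \<le> \<bar>r\<bar> ^ (k - 1) * norm x"
      by (rule not_less_Least) (use kS in \<open>simp add: k_def[symmetric]\<close>)
    then have "\<bar>r\<bar> * (\<bar>r\<bar> ^ (k - 1) * norm x) \<le> \<bar>r\<bar> * 1" using r by (intro mult_left_mono) auto
    then have "\<bar>r\<bar> ^ k * norm x \<le> \<bar>r\<bar>" by (subst kS) (simp add: mult.assoc)
    then show ?thesis using x(1) k \<open>n < k\<close> by (intro exI[of _ x] exI[of _ k]) simp
  qed
  then obtain x k where xk: "\<And>n. x n \<in> S" "\<And>n. n \<le> k n" "\<And>n. 1 \<le> \<bar>r\<bar> ^ k n * norm (x n)"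
      "\<And>n. \<bar>r\<bar> ^ k n * norm (x n) \<le> \<bar>r\<bar>" by metis
  define z where "z = (\<lambda>n. r ^ k n *\<^sub>R x n)"
  have nz: "norm (z n) = \<bar>r\<bar> ^ k n * norm (x n)" for n by (simp add: z_def power_abs)
  have "z n \<in> cball 0 \<bar>r\<bar>" for n using xk(4)[of n] by (simp add: nz)
  then obtain \<zeta> s where s: "strict_mono s" "(z \<circ> s) \<longlonglongrightarrow> \<zeta>"
    using compact_cball[of "0 :: 'a" "\<bar>r\<bar>"] unfolding compact_def by metis
  have "1 \<le> norm \<zeta>"
    using Lim_bounded2[OF tendsto_norm[OF s(2)], of 0 1] xk(3) by (simp add: nz)
  then have "\<zeta> \<noteq> 0" by auto
  have "filterlim k at_top sequentially"
    by (rule filterlim_at_top_mono[OF filterlim_ident]) (simp add: xk(2))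
  then have "filterlim (\<lambda>n. k (s n)) at_top sequentially"
    by (rule filterlim_compose[OF _ filterlim_subseq[OF s(1)]])
  moreover have "(1 / r ^ k (s n)) *\<^sub>R (z \<circ> s) n \<in> S" for n using xk(1)[of "s n"] r by (auto simp: z_def)
  ultimately show ?thesis using that s(2) \<open>\<zeta> \<noteq> 0\<close> by blast
qed

text \<open>
  This is the heart of the proof. The set \<open>T\<close> of the scalars \<open>t\<close> such that all \<open>(t / r\<^sup>j) v\<close> are in
  \<open>S\<close> is closed, symmetric, not reduced to \<open>0\<close>, and stable under multiplication by \<open>r\<close>, \<open>1 / r\<close> and all
  coefficients \<open>\<phi> (h v)\<close>: apply \<open>renormalised_limit\<close> to the constant sequence \<open>t h v\<close>. The
  logarithms of its positive multipliers form a closed additive semigroup \<open>B\<close> containing \<open>\<plusminus> ln \<bar>r\<bar>\<close>.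

  If \<open>B\<close> were not everything, it would be discrete. But \<open>c n = \<phi> (h A\<^sup>n k v) / r\<^sup>n\<close> is
  a multiplier that converges to \<open>\<phi> (h v) \<phi> (k v) \<noteq> 0\<close>, so it would be eventually constant. As \<open>c n\<close> differs
  from its limit by \<open>\<phi> (h A\<^sup>n y) / r\<^sup>n\<close> with \<open>y = k v - \<phi> (k v) v\<close>, \<open>vanishing_backwards\<close> yields
  \<open>\<phi> (h y) = 0\<close>, that is \<open>\<phi> (h k v) = \<phi> (h v) \<phi> (k v)\<close>, contrary to \<open>coefficient_not_multiplicative\<close>.
\<close>

lemma dominant_line_subset:
  fixes \<Gamma> :: "(real^'n^'n) set" and S :: "(real^'n) set"
  assumes card: "CARD('n) > 1" and GL: "GL_subsemigroup \<Gamma>" and irr: "strongly_irreducible \<Gamma>"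
    and A: "A \<in> \<Gamma>" and r: "1 < \<bar>r\<bar>" and \<phi>: "linear \<phi>" "\<phi> v = 1" and Av: "A *v v = r *\<^sub>R v"
    and conv: "\<And>x. (\<lambda>n. (1 / r ^ n) *\<^sub>R ((*v) A ^^ n) x) \<longlonglongrightarrow> \<phi> x *\<^sub>R v"
    and S: "closed S" "\<And>x. x \<in> S \<Longrightarrow> - x \<in> S" "\<And>\<gamma> x. \<gamma> \<in> \<Gamma> \<Longrightarrow> x \<in> S \<Longrightarrow> \<gamma> *v x \<in> S"
    and small: "0 \<in> closure (S - {0})"
  shows "t *\<^sub>R v \<in> S"
proof -
  have ne: "\<Gamma> \<noteq> {}" using A by blast
  have r0: "r \<noteq> 0" using r by auto
  define T where "T = {t. \<forall>j::nat. (t / r ^ j) *\<^sub>R v \<in> S}"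
  have TI: "\<phi> \<zeta> \<in> T" if k: "filterlim k at_top sequentially" and z: "z \<longlonglongrightarrow> \<zeta>"
    and zS: "\<And>n. (1 / r ^ k n) *\<^sub>R z n \<in> S" for k z \<zeta>
  proof -
    have "(\<phi> \<zeta> / r ^ j) *\<^sub>R v \<in> S" for j
    proof -
      have "\<phi> ((1 / r ^ j) *\<^sub>R \<zeta>) *\<^sub>R v \<in> S"
      proof (rule renormalised_limit[OF conv \<phi>(1) S(1) S(3)[OF A]])
        \<comment> \<open>The exponents are lowered by \<open>j\<close> and the vectors divided by \<open>r\<^sup>j\<close>, so that the points of \<open>S\<close> remain
          the same.\<close>
        show "filterlim (\<lambda>n. k n - j) at_top sequentially"
          using k filterlim_minus_const_nat_at_top filterlim_compose by blast
        show "(\<lambda>n. (1 / r ^ j) *\<^sub>R z n) \<longlonglongrightarrow> (1 / r ^ j) *\<^sub>R \<zeta>" by (intro tendsto_intros z)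
        have "\<forall>\<^sub>F n in sequentially. j \<le> k n" using k by (simp add: filterlim_at_top)
        then show "\<forall>\<^sub>F n in sequentially. (1 / r ^ (k n - j)) *\<^sub>R (1 / r ^ j) *\<^sub>R z n \<in> S"
        proof eventually_elim
          case (elim n)
          then have "r ^ (k n - j) * r ^ j = r ^ k n" by (simp flip: power_add)
          then show ?case using zS[of n] by simp
        qed
      qed
      then show ?thesis by (simp add: linear_scale[OF \<phi>(1)])
    qed
    then show ?thesis by (simp add: T_def)
  qed
  have "T = (\<Inter>j. (\<lambda>t. (t / r ^ j) *\<^sub>R v) -` S)" by (auto simp: T_def)
  then have T_closed: "closed T" using r0 by (auto intro!: closed_INT closed_vimage S(1) continuous_intros)
  have T_neg: "- t \<in> T" if "t \<in> T" for t using that S(2) by (fastforce simp: T_def)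
  have T_div: "t / r ^ n \<in> T" if "t \<in> T" for t n
    using that by (auto simp: T_def simp flip: power_add)
  have T_mul: "r * t \<in> T" if t: "t \<in> T" for t
  proof -
    have "(r * t / r ^ j) *\<^sub>R v \<in> S" for j
    proof (cases j)
      case 0
      have "A *v ((t / r ^ 0) *\<^sub>R v) \<in> S" using t S(3)[OF A] unfolding T_def by blast
      then show ?thesis using 0 by (simp add: matrix_vector_mult_scaleR Av mult.commute)
    next
      case (Suc i)
      have "(t / r ^ i) *\<^sub>R v \<in> S" using t unfolding T_def by blast
      then show ?thesis using Suc r0 by simp
    qed
    then show ?thesis by (simp add: T_def)
  qed
  have T_coeff: "\<phi> (h *v v) * t \<in> T" if h: "h \<in> \<Gamma>" and t: "t \<in> T" for h t
  proof -
    have "(1 / r ^ n) *\<^sub>R (t *\<^sub>R (h *v v)) \<in> S" for n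
    proof -
      have "h *v ((t / r ^ n) *\<^sub>R v) \<in> S" using t S(3)[OF h] unfolding T_def by blast
      then show ?thesis by (simp add: matrix_vector_mult_scaleR)
    qed
    then have "\<phi> (t *\<^sub>R (h *v v)) \<in> T" by (intro TI[OF filterlim_ident tendsto_const])
    then show ?thesis by (simp add: linear_scale[OF \<phi>(1)] mult.commute)
  qed
  obtain t0 where t0: "t0 \<in> T" "t0 \<noteq> 0"
  proof -
    obtain z \<zeta> k where z: "filterlim k at_top sequentially" "z \<longlonglongrightarrow> \<zeta>" "\<zeta> \<noteq> 0"
      "\<And>n. (1 / r ^ k n) *\<^sub>R z n \<in> S" using rescale_small_vectors[OF r small] by metis
    obtain h where h: "h \<in> \<Gamma>" "\<phi> (h *v \<zeta>) \<noteq> 0"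
      using orbit_avoids_two_kernels[OF GL irr ne z(3) \<phi>(1) _ \<phi>(1), of v v] \<phi>(2) by auto
    have "(\<lambda>n. h *v z n) \<longlonglongrightarrow> h *v \<zeta>"
      by (rule bounded_linear.tendsto[OF matrix_vector_mul_bounded_linear z(2)])
    moreover have "(1 / r ^ k n) *\<^sub>R (h *v z n) \<in> S" for n
      using S(3)[OF h(1) z(4)[of n]] by (simp add: matrix_vector_mult_scaleR)
    ultimately have "\<phi> (h *v \<zeta>) \<in> T" using TI[OF z(1)] by blast
    then show ?thesis using that h(2) by blast
  qed
  define B where "B = {a. \<forall>t\<in>T. exp a * t \<in> T}"
  have "B = (\<Inter>t\<in>T. (\<lambda>a. exp a * t) -` T)" by (auto simp: B_def)
  then have B_closed: "closed B" by (auto intro!: closed_INT closed_vimage T_closed continuous_intros)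
  have B_add: "a + b \<in> B" if "a \<in> B" "b \<in> B" for a b using that by (auto simp: B_def exp_add mult.assoc)
  have BI: "ln \<bar>c\<bar> \<in> B" if c: "c \<noteq> 0" "\<And>t. t \<in> T \<Longrightarrow> c * t \<in> T" for c
    unfolding B_def using c T_neg by (auto simp: abs_if)
  have B_r: "ln \<bar>r\<bar> \<in> B" using BI[OF r0] T_mul by blast
  have B_r': "- ln \<bar>r\<bar> \<in> B"
    using BI[of "1 / r"] T_div[of _ 1] r0 by (simp add: ln_div)
  have "B = UNIV"
  proof (rule ccontr)
    assume "B \<noteq> UNIV"
    then obtain e where e: "0 < e" "\<And>a b. a \<in> B \<Longrightarrow> b \<in> B \<Longrightarrow> \<bar>a - b\<bar> < e \<Longrightarrow> a = b"
      using closed_semigroup_containing_period_is_discrete[OF B_closed B_add _ B_r B_r'] r by auto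
    obtain h k where hk: "h \<in> \<Gamma>" "k \<in> \<Gamma>" "\<phi> (h *v v) \<noteq> 0" "\<phi> (k *v v) \<noteq> 0"
        and nm: "\<phi> (h *v (k *v v)) \<noteq> \<phi> (h *v v) * \<phi> (k *v v)"
      using coefficient_not_multiplicative[OF card GL irr ne \<phi>] by blast
    define \<psi> where "\<psi> = (\<lambda>x. \<phi> (h *v x))"
    have \<psi>: "linear \<psi>" unfolding \<psi>_def
      using linear_compose[OF matrix_vector_mul_linear \<phi>(1)] by (simp add: o_def)
    define l where "l = \<phi> (h *v v) * \<phi> (k *v v)"
    have l0: "l \<noteq> 0" using hk by (simp add: l_def)
    define c where "c = (\<lambda>n. \<psi> (((*v) A ^^ n) (k *v v)) / r ^ n)"
    have "(\<lambda>n. \<psi> ((1 / r ^ n) *\<^sub>R ((*v) A ^^ n) (k *v v))) \<longlonglongrightarrow> \<psi> (\<phi> (k *v v) *\<^sub>R v)"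
      by (rule bounded_linear.tendsto[OF linear_linear[THEN iffD2, OF \<psi>] conv])
    then have c_lim: "c \<longlonglongrightarrow> l"
      by (simp add: c_def l_def linear_scale[OF \<psi>] mult.commute) (simp add: \<psi>_def mult.commute)
    have B_c: "ln \<bar>c n\<bar> \<in> B" if "c n \<noteq> 0" for n
    proof (rule BI[OF that])
      \<comment> \<open>\<open>c n\<close> is the coefficient of the semigroup element \<open>h A\<^sup>n k\<close> divided by \<open>r\<^sup>n\<close>.\<close>
      have "\<exists>\<delta>\<in>\<Gamma>. \<delta> *v v = ((*v) A ^^ n) (k *v v)"
      proof (induction n)
        case (Suc n)
        then obtain \<delta> where "\<delta> \<in> \<Gamma>" "\<delta> *v v = ((*v) A ^^ n) (k *v v)" by blast
        then show ?case using GL A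
          by (intro bexI[of _ "A ** \<delta>"]) (auto simp: GL_subsemigroup_def matrix_vector_mul_assoc[symmetric])
      qed (use hk(2) in auto)
      then obtain \<delta> where \<delta>: "\<delta> \<in> \<Gamma>" "\<delta> *v v = ((*v) A ^^ n) (k *v v)" by blast
      fix t assume t: "t \<in> T"
      have "h ** \<delta> \<in> \<Gamma>" using GL hk(1) \<delta>(1) by (auto simp: GL_subsemigroup_def)
      from T_div[OF T_coeff[OF this t], of n] show "c n * t \<in> T"
        by (simp add: c_def \<psi>_def \<delta>(2) matrix_vector_mul_assoc[symmetric])
    qed
    have B_l: "ln \<bar>l\<bar> \<in> B"
      using BI[OF l0] T_coeff[OF hk(1) T_coeff[OF hk(2)]] by (simp add: l_def mult.assoc)
    have "(\<lambda>n. ln \<bar>c n\<bar>) \<longlonglongrightarrow> ln \<bar>l\<bar>" using l0 by (intro tendsto_intros c_lim) auto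
    then have "\<forall>\<^sub>F n in sequentially. \<bar>ln \<bar>c n\<bar> - ln \<bar>l\<bar>\<bar> < e"
      using e(1) unfolding tendsto_iff dist_real_def by blast
    moreover have "\<forall>\<^sub>F n in sequentially. \<bar>c n - l\<bar> < \<bar>l\<bar>"
      using c_lim l0 unfolding tendsto_iff dist_real_def by (meson zero_less_abs_iff)
    ultimately have "\<forall>\<^sub>F n in sequentially. c n = l"
    proof eventually_elim
      case (elim n)
      then have cn: "c n \<noteq> 0" by auto
      have "ln \<bar>c n\<bar> = ln \<bar>l\<bar>" using e(2)[OF B_c[OF cn] B_l] elim(1) by blast
      then have "\<bar>c n\<bar> = \<bar>l\<bar>" using cn l0 by (metis exp_ln zero_less_abs_iff)
      then show ?case using elim(2) by linarith
    qed
    then obtain N where N: "\<And>n. n \<ge> N \<Longrightarrow> c n = l" by (auto simp: eventually_sequentially)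
    define y where "y = k *v v - \<phi> (k *v v) *\<^sub>R v"
    have Anv: "((*v) A ^^ n) v = r ^ n *\<^sub>R v" for n
      by (induction n) (simp_all add: matrix_vector_mult_scaleR Av)
    have "\<psi> y = 0"
    proof (rule vanishing_backwards[OF _ \<psi>])
      show "invertible A" using GL A by (auto simp: GL_subsemigroup_def)
      fix n assume "N \<le> n"
      then have "\<psi> (((*v) A ^^ n) (k *v v)) = l * r ^ n" using N[of n] r0 by (simp add: c_def field_simps)
      then show "\<psi> (((*v) A ^^ n) y) = 0"
        by (simp add: y_def linear_diff[OF linear_matrix_iterate] linear_scale[OF linear_matrix_iterate]
            Anv linear_diff[OF \<psi>] linear_scale[OF \<psi>]) (simp add: \<psi>_def l_def)
    qed
    then show False using nm
      by (simp add: y_def linear_diff[OF \<psi>] linear_scale[OF \<psi>]) (simp add: \<psi>_def mult.commute)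
  qed
  show ?thesis
  proof (cases "t = 0")
    case True
    have "0 \<in> closure S" using small closure_mono[of "S - {0}" S] by blast
    then show ?thesis using True S(1) by simp
  next
    case False
    have "exp (ln (\<bar>t\<bar> / \<bar>t0\<bar>)) * t0 \<in> T" using \<open>B = UNIV\<close> t0(1) by (auto simp: B_def)
    then have "\<bar>t\<bar> / \<bar>t0\<bar> * t0 \<in> T" using False t0(2) by simp
    then have "t \<in> T" using T_neg[of "- t"] t0(2) by (cases "t0 > 0"; cases "t > 0") auto
    then have "(t / r ^ 0) *\<^sub>R v \<in> S" unfolding T_def by blast
    then show ?thesis by simp
  qed
qed

text \<open>
  One line in \<open>S\<close> suffices: move it by some \<open>\<gamma>\<close> off the repelling hyperplane of \<open>h\<close>. The points
  \<open>r\<^sup>-\<^sup>n z\<close> with \<open>z\<close> on the moved line are then all in \<open>S\<close>, and \<open>h\<^sup>n\<close> sends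
  them towards the dominant line of \<open>h\<close>.
\<close>

lemma all_dominant_lines_subset:
  fixes \<Gamma> :: "(real^'n^'n) set" and S :: "(real^'n) set"
  assumes GL: "GL_subsemigroup \<Gamma>" and irr: "strongly_irreducible \<Gamma>"
    and S: "closed S" "\<And>\<gamma> x. \<gamma> \<in> \<Gamma> \<Longrightarrow> x \<in> S \<Longrightarrow> \<gamma> *v x \<in> S"
    and v: "v \<noteq> 0" "\<And>t. t *\<^sub>R v \<in> S"
    and h: "h \<in> \<Gamma>" "dominant_eigenvector h w"
  shows "t *\<^sub>R w \<in> S"
proof -
  obtain r' where r': "dominant_eigenvalue h (complex_of_real r')" "h *v w = r' *\<^sub>R w"
    using h(2) by (auto simp: dominant_eigenvector_def)
  have inv: "invertible h" using GL h(1) by (auto simp: GL_subsemigroup_def)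
  obtain r u \<phi> where D: "complex_of_real r' = complex_of_real r" "r \<noteq> 0" "linear \<phi>" "\<phi> u = 1"
    "h *v u = r *\<^sub>R u"
    "\<forall>x. (\<lambda>n. (1 / r ^ n) *\<^sub>R ((*v) h ^^ n) x) \<longlonglongrightarrow> \<phi> x *\<^sub>R u"
    by (rule dominant_projection[OF inv r'(1)])
  have "((*v) h ^^ n) w = r ^ n *\<^sub>R w" for n
    by (induction n) (use D(1) in \<open>simp_all add: matrix_vector_mult_scaleR r'(2)\<close>)
  then have "(\<lambda>n. w) \<longlonglongrightarrow> \<phi> w *\<^sub>R u" using D(6)[rule_format, of w] D(2) by simp
  then have w: "w = \<phi> w *\<^sub>R u" by (simp add: LIMSEQ_const_iff)
  obtain \<gamma> where \<gamma>: "\<gamma> \<in> \<Gamma>" "\<phi> (\<gamma> *v v) \<noteq> 0"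
    using orbit_avoids_two_kernels[OF GL irr _ v(1) D(3) _ D(3), of u u] h(1) D(4) by auto
  define z where "z = (t * \<phi> w / \<phi> (\<gamma> *v v)) *\<^sub>R (\<gamma> *v v)"
  have "\<phi> z *\<^sub>R u \<in> S"
  proof (rule renormalised_limit[OF D(6)[rule_format] D(3) S(1) S(2)[OF h(1)] filterlim_ident tendsto_const])
    have "(1 / r ^ n) *\<^sub>R z \<in> S" for n
      using S(2)[OF \<gamma>(1) v(2)] by (simp add: z_def flip: matrix_vector_mult_scaleR)
    then show "\<forall>\<^sub>F n in sequentially. (1 / r ^ n) *\<^sub>R z \<in> S" by simp
  qed
  moreover have "\<phi> z = t * \<phi> w" using \<gamma>(2) by (simp add: z_def linear_scale[OF D(3)])
  ultimately show ?thesis by (metis w scaleR_scaleR)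
qed

section \<open>Passage to the quotients\<close>

lemma closedin_lines_in_closed:
  assumes "closed S"
  shows "closedin projective_space {direction w |w. w \<noteq> 0 \<and> (\<forall>t. t *\<^sub>R w \<in> S)}" (is "closedin _ ?D")
proof -
  have q: "quotient_map (top_of_set (- {0})) projective_space (direction :: real^'n \<Rightarrow> _)"
    unfolding projective_space_def by (rule quotient_map_quotient_topology)
  have eq: "{x \<in> - {0}. direction x \<in> ?D} = - {0} \<inter> (\<Inter>t. (\<lambda>x. t *\<^sub>R x) -` S)"
  proof (intro set_eqI iffI)
    fix x assume "x \<in> {x \<in> - {0}. direction x \<in> ?D}"
    then obtain w where w: "x \<noteq> 0" "span {x} = span {w}" "\<forall>t. t *\<^sub>R w \<in> S"
      by (auto simp: direction_def)
    then obtain c where "x = c *\<^sub>R w" using span_base[of x "{x}"] by (auto simp: span_singleton)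
    then show "x \<in> - {0} \<inter> (\<Inter>t. (\<lambda>x. t *\<^sub>R x) -` S)" using w by auto
  qed auto
  have "closed (\<Inter>t. (\<lambda>x. t *\<^sub>R x) -` S)"
    by (auto intro!: closed_INT closed_vimage assms continuous_intros)
  then have "closedin (top_of_set (- {0})) {x \<in> - {0}. direction x \<in> ?D}"
    unfolding eq by (rule closedin_closed_Int)
  moreover have "?D \<subseteq> topspace projective_space"
    unfolding projective_space_def by auto
  ultimately show ?thesis using q[unfolded quotient_map_closedin, THEN conjunct2, rule_format, of ?D]
    by (simp only: topspace_euclidean_subtopology)
qed

text \<open>
  Balls centred at \<open>0\<close> are symmetric, so their images are open in the quotient.
\<close>

lemma zero_in_closure_pm_preimage:
  fixes \<Sigma> :: "(real^'n) set set"
  assumes "pm_class 0 \<in> pm_space closure_of \<Sigma>" "\<Sigma> \<subseteq> topspace pm_space - {pm_class 0}"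
  shows "0 \<in> closure ({x. pm_class x \<in> \<Sigma>} - {0})"
  unfolding closure_approachable
proof (intro allI impI)
  fix e :: real assume e: "0 < e"
  have "{x. pm_class x \<in> pm_class ` ball 0 e} = (ball 0 e :: (real^'n) set)"
    by (auto simp: pm_class_def doubleton_eq_iff)
  then have "openin pm_space (pm_class ` (ball 0 e :: (real^'n) set))"
    by (auto simp: pm_space_def openin_quotient_topology)
  then obtain y where "y \<in> \<Sigma>" "y \<in> pm_class ` ball 0 e"
    using assms(1) e unfolding in_closure_of by (metis centre_in_ball imageI)
  then obtain x where x: "pm_class x \<in> \<Sigma>" "norm x < e" by auto
  moreover have "x \<noteq> 0" using x(1) assms(2) by auto
  ultimately show "\<exists>y\<in>{x. pm_class x \<in> \<Sigma>} - {0}. dist y 0 < e" by (intro bexI[of _ x]) auto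
qed

lemma pm_class_closure_preimage:
  fixes \<Sigma> :: "(real^'n) set set"
  shows   "pm_class ` closure {x. pm_class x \<in> \<Sigma>} \<subseteq> pm_space closure_of \<Sigma>"
proof -
  have "continuous_map euclidean pm_space (pm_class :: real^'n \<Rightarrow> _)"
    unfolding pm_space_def by (rule quotient_imp_continuous_map[OF quotient_map_quotient_topology])
  then have "pm_class ` (euclidean closure_of {x :: real^'n. pm_class x \<in> \<Sigma>})
      \<subseteq> pm_space closure_of (pm_class ` {x. pm_class x \<in> \<Sigma>})"
    by (rule continuous_map_image_closure_subset)
  also have "\<dots> \<subseteq> pm_space closure_of \<Sigma>" by (rule closure_of_mono) auto
  finally show ?thesis by (simp add: euclidean_closure_of)
qed

theorem theorem1p2:
  fixes \<Gamma> :: "(real ^ 'n ^ 'n) set"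
    and \<Sigma> :: "(real ^ 'n) set set"
  assumes "CARD('n) > 1"
    and "GL_subsemigroup \<Gamma>"
    and "strongly_irreducible \<Gamma>"
    and "\<exists>\<gamma>\<in>\<Gamma>. proximal \<gamma> \<and> expanding \<gamma>"
    and "\<Sigma> \<subseteq> topspace pm_space - {pm_class 0}"
    and "pm_invariant \<Gamma> \<Sigma>"
    and "pm_class 0 \<in> pm_space closure_of \<Sigma>"
  shows "pm_class ` limit_cone \<Gamma> \<subseteq> pm_space closure_of \<Sigma>"
proof -
  define S0 where "S0 = {x. pm_class x \<in> \<Sigma>}"
  define S where "S = closure S0"
  have S_closed: "closed S" by (simp add: S_def)
  have S_neg: "- x \<in> S" if "x \<in> S" for x
  proof -
    have "uminus ` closure S0 \<subseteq> closure S0"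
    proof (rule image_closure_subset)
      have "- y \<in> S0" if "y \<in> S0" for y
        using that by (simp add: S0_def pm_class_def insert_commute)
      then show "uminus ` S0 \<subseteq> closure S0" using closure_subset by blast
    qed (auto intro: continuous_intros)
    then show ?thesis using that unfolding S_def by blast
  qed
  have S_inv: "\<gamma> *v x \<in> S" if \<gamma>: "\<gamma> \<in> \<Gamma>" and x: "x \<in> S" for \<gamma> x
  proof -
    have "(*v) \<gamma> ` closure S0 \<subseteq> closure S0"
    proof (rule image_closure_subset)
      have "\<gamma> *v y \<in> S0" if "y \<in> S0" for y
        using assms(6) \<gamma> that pm_act_pm_class[of \<gamma> y] unfolding pm_invariant_def S0_def by auto
      then show "(*v) \<gamma> ` S0 \<subseteq> closure S0" using closure_subset by blast
    qed (auto intro: linear_continuous_on)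
    then show ?thesis using x unfolding S_def by blast
  qed
  have "S0 - {0} \<subseteq> S - {0}" unfolding S_def using closure_subset by blast
  then have S_small: "0 \<in> closure (S - {0})"
    using zero_in_closure_pm_preimage[OF assms(7,5)] closure_mono unfolding S0_def[symmetric] by blast
  obtain A l where A: "A \<in> \<Gamma>" "dominant_eigenvalue A l" "expanding A"
    using assms(4) by (auto simp: proximal_def)
  have inv: "invertible A" using assms(2) A(1) by (auto simp: GL_subsemigroup_def)
  obtain r v \<phi> where D: "l = complex_of_real r" "r \<noteq> 0" "linear \<phi>" "\<phi> v = 1"
    "A *v v = r *\<^sub>R v"
    "\<forall>x. (\<lambda>n. (1 / r ^ n) *\<^sub>R ((*v) A ^^ n) x) \<longlonglongrightarrow> \<phi> x *\<^sub>R v"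
    by (rule dominant_projection[OF inv A(2)])
  have r: "1 < \<bar>r\<bar>" using expanding_dominant[OF A(3,2)] D(1) by simp
  have v: "v \<noteq> 0" using D(3,4) linear_0 by fastforce
  have line: "t *\<^sub>R v \<in> S" for t
    using dominant_line_subset[OF assms(1-3) A(1) r D(3-5) D(6)[rule_format] S_closed S_neg S_inv S_small] .
  have "limit_set \<Gamma> \<subseteq> {direction w |w. w \<noteq> 0 \<and> (\<forall>t. t *\<^sub>R w \<in> S)}"
    unfolding limit_set_def
  proof (rule closure_of_minimal[OF _ closedin_lines_in_closed[OF S_closed]])
    have "w \<noteq> 0 \<and> (\<forall>t. t *\<^sub>R w \<in> S)" if "h \<in> \<Gamma>" "dominant_eigenvector h w" for h w
      using all_dominant_lines_subset[OF assms(2,3) S_closed S_inv v line that] that(2)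
      by (simp add: dominant_eigenvector_def)
    then show "{direction v |v \<gamma>. \<gamma> \<in> \<Gamma> \<and> proximal \<gamma> \<and> dominant_eigenvector \<gamma> v}
        \<subseteq> {direction w |w. w \<noteq> 0 \<and> (\<forall>t. t *\<^sub>R w \<in> S)}" by blast
  qed
  then have "limit_cone \<Gamma> \<subseteq> S"
  proof -
    have "x \<in> S" if D: "direction x \<in> {direction w |w. w \<noteq> 0 \<and> (\<forall>t. t *\<^sub>R w \<in> S)}" for x
    proof -
      obtain w where w: "span {x} = span {w}" "\<forall>t. t *\<^sub>R w \<in> S" using D by (auto simp: direction_def)
      then obtain c where "x = c *\<^sub>R w" using span_base[of x "{x}"] by (auto simp: span_singleton)
      then show ?thesis using w(2) by blast
    qed
    then show ?thesis using \<open>limit_set \<Gamma> \<subseteq> _\<close> unfolding limit_cone_def by blast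
  qed
  then show ?thesis using pm_class_closure_preimage[of \<Sigma>] unfolding S_def S0_def by blast
qed

end
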